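(* Let $D$ be a division ring and $m,n\in\mathbb{N}$. (i) There exists an isomorphism of lattices $\phi:\mathcal{LS}_{m\times n}\to\mathcal{R}_n$ with the property that $I=M_{m\times n}(D)\,\phi(I)$ for all $I\in\mathcal{LS}_{m\times n}$. In particular, the lattices $\mathcal{LS}_{m\times n}$, $m\in\mathbb{N}$, are all isomorphic to $\mathcal{R}_n$. (ii) There exists an isomorphism of lattices $\phi:\mathcal{RS}_{m\times n}\to\mathcal{C}_m$ with the property that $I=\phi(I)\,M_{m\times n}(D)$ for all $I\in\mathcal{RS}_{m\times n}$. In particular, the lattices $\mathcal{RS}_{m\times n}$, $n\in\mathbb{N}$, are all isomorphic to $\mathcal{C}_m$.
   Context: $M_{m\times n}(D)$ is the set of all $m\times n$ matrices over $D$, viewed as an $(M_m(D),M_n(D))$-bimodule via matrix multiplication, where $M_n(D):=M_{n\times n}(D)$. $\mathcal{LS}_{m\times n}$ is the set of all left $M_m(D)$-submodules of $M_{m\times n}(D)$, and $\mathcal{RS}_{m\times n}$ is the set of all right $M_n(D)$-submodules of $M_{m\times n}(D)$; both are lattices with join $+$ and meet $\cap$. For a matrix $R$ and a set $\mathcal{S}$ of matrices, $\mathcal{S}R=\{XR:X\in\mathcal{S}\}$ and $R\mathcal{S}=\{RX:X\in\mathcal{S}\}$. $D_n:=M_{1\times n}(D)$ is a left $D$-vector space and $D^m:=M_{m\times 1}(D)$ is a right $D$-vector space. ${\rm LRS}(A)$ denotes the left row space of $A$ (the left $D$-span of its rows), and ${\rm RCS}(A)$ the right column space (the right $D$-span of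 its columns). $\mathcal{R}_n$ is the set of $n\times n$ left row reduced echelon matrices over $D$: zero rows come last, the first nonzero entry (leading entry) of each nonzero row is $1$, the column positions of the leading entries strictly increase with the row index, and each leading entry is the only nonzero entry of its column. $\mathcal{C}_m$ is the set of $m\times m$ right column reduced echelon matrices over $D$, defined by the same conditions with the roles of rows and columns interchanged. Every left subspace of $D_n$ is ${\rm LRS}(R)$ for a unique $R\in\mathcal{R}_n$, and every right subspace of $D^m$ is ${\rm RCS}(C)$ for a unique $C\in\mathcal{C}_m$. The lattice operations on $\mathcal{R}_n$ are defined by letting $R_1\vee R_2$ and $R_1\wedge R_2$ be the unique elements of $\mathcal{R}_n$ with ${\rm LRS}(R_1\vee R_2)={\rm LRS}(R_1)+{\rm LRS}(R_2)$ and ${\rm LRS}(R_1\wedge R_2)={\rm LRS}(R_1)\cap{\rm LRS}(R_2)$; those on $\mathcal{C}_m$ are defined in the same way using ${\rm RCS}$. *)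

theory Defs
  imports
    "Jordan_Normal_Form.Gauss_Jordan_Elimination"
    "HOL-Library.Set_Algebras"
begin

text \<open>
  The division ring \<open>D\<close> is a type \<open>'a\<close> of class \<^class>\<open>division_ring\<close>; multiplication need not be
  commutative. The matrix product of \<open>Jordan_Normal_Form\<close> only needs a semiring and multiplies
  entries in the order \<open>A $$ (i,k) * B $$ (k,j)\<close>. The sum of two sets of matrices is the
  elementwise one of \<^theory>\<open>HOL-Library.Set_Algebras\<close>.
\<close>

section \<open>Lattices given by a carrier and two operations\<close>

text \<open>The locale \<open>lattice\<close> of HOL-Algebra starts from an order; the lattices considered here are
  presented by their join and meet.\<close>

record 'l lattice_ops =
  elems :: "'l set"
  lub :: "'l \<Rightarrow> 'l \<Rightarrow> 'l"
  glb :: "'l \<Rightarrow> 'l \<Rightarrow> 'l"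

definition is_lattice :: "'l lattice_ops \<Rightarrow> bool" where
  "is_lattice L \<longleftrightarrow>
     (\<forall>x\<in>elems L. \<forall>y\<in>elems L.
        lub L x y \<in> elems L \<and> glb L x y \<in> elems L \<and>
        lub L x y = lub L y x \<and> glb L x y = glb L y x \<and>
        lub L x (glb L x y) = x \<and> glb L x (lub L x y) = x) \<and>
     (\<forall>x\<in>elems L. \<forall>y\<in>elems L. \<forall>z\<in>elems L.
        lub L (lub L x y) z = lub L x (lub L y z) \<and>
        glb L (glb L x y) z = glb L x (glb L y z))"

definition lattice_iso :: "('l \<Rightarrow> 'k) \<Rightarrow> 'l lattice_ops \<Rightarrow> 'k lattice_ops \<Rightarrow> bool" where
  "lattice_iso \<phi> L K \<longleftrightarrow>
     is_lattice L \<and> is_lattice K \<and>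
     bij_betw \<phi> (elems L) (elems K) \<and>
     (\<forall>x\<in>elems L. \<forall>y\<in>elems L.
        \<phi> (lub L x y) = lub K (\<phi> x) (\<phi> y) \<and> \<phi> (glb L x y) = glb K (\<phi> x) (\<phi> y))"

definition lattice_isomorphic :: "'l lattice_ops \<Rightarrow> 'k lattice_ops \<Rightarrow> bool" where
  "lattice_isomorphic L K \<longleftrightarrow> (\<exists>\<phi>. lattice_iso \<phi> L K)"


section \<open>Submodules of the bimodule of matrices\<close>

text \<open>The notion of module in HOL-Algebra is restricted to commutative rings of scalars. Closure
  under additive inverses follows from closure under multiplication by \<open>- 1\<^sub>m m\<close>.\<close>

definition left_submodules :: "nat \<Rightarrow> nat \<Rightarrow> 'a :: division_ring mat set set" where
  "left_submodules m n =
     {I. I \<subseteq> carrier_mat m n \<and> 0\<^sub>m m n \<in> I \<and>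
         (\<forall>X\<in>I. \<forall>Y\<in>I. X + Y \<in> I) \<and>
         (\<forall>A\<in>carrier_mat m m. \<forall>X\<in>I. A * X \<in> I)}"

definition right_submodules :: "nat \<Rightarrow> nat \<Rightarrow> 'a :: division_ring mat set set" where
  "right_submodules m n =
     {I. I \<subseteq> carrier_mat m n \<and> 0\<^sub>m m n \<in> I \<and>
         (\<forall>X\<in>I. \<forall>Y\<in>I. X + Y \<in> I) \<and>
         (\<forall>A\<in>carrier_mat n n. \<forall>X\<in>I. X * A \<in> I)}"

definition LS :: "nat \<Rightarrow> nat \<Rightarrow> 'a :: division_ring mat set lattice_ops" where
  "LS m n = \<lparr> elems = left_submodules m n, lub = (+), glb = (\<inter>) \<rparr>"

definition RS :: "nat \<Rightarrow> nat \<Rightarrow> 'a :: division_ring mat set lattice_ops" where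
  "RS m n = \<lparr> elems = right_submodules m n, lub = (+), glb = (\<inter>) \<rparr>"

definition set_times_mat :: "'a :: division_ring mat set \<Rightarrow> 'a mat \<Rightarrow> 'a mat set" where
  "set_times_mat S R = {X * R | X. X \<in> S}"

definition mat_times_set :: "'a :: division_ring mat \<Rightarrow> 'a mat set \<Rightarrow> 'a mat set" where
  "mat_times_set R S = {R * X | X. X \<in> S}"


section \<open>Row and column spaces\<close>

text \<open>Sets of \<open>1 \<times> n\<close> respectively \<open>m \<times> 1\<close> matrices. The scalars \<open>c\<close> stand on the left of the rows
  and on the right of the columns.\<close>

definition LRS :: "'a :: division_ring mat \<Rightarrow> 'a mat set" where
  "LRS A = {mat 1 (dim_col A) (\<lambda>(_, j). \<Sum>i<dim_row A. c i * A $$ (i, j)) | c. True}"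

definition RCS :: "'a :: division_ring mat \<Rightarrow> 'a mat set" where
  "RCS A = {mat (dim_row A) 1 (\<lambda>(i, _). \<Sum>j<dim_col A. A $$ (i, j) * c j) | c. True}"


section \<open>Reduced echelon matrices\<close>

definition zero_row :: "'a :: division_ring mat \<Rightarrow> nat \<Rightarrow> bool" where
  "zero_row A i \<longleftrightarrow> (\<forall>j<dim_col A. A $$ (i, j) = 0)"

text \<open>The column of the leading entry of row \<open>i\<close>; meaningful only if that row is nonzero.\<close>

definition lead_pos :: "'a :: division_ring mat \<Rightarrow> nat \<Rightarrow> nat" where
  "lead_pos A i = (LEAST j. j < dim_col A \<and> A $$ (i, j) \<noteq> 0)"

definition row_reduced_echelon :: "'a :: division_ring mat \<Rightarrow> bool" where
  "row_reduced_echelon A \<longleftrightarrow>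
     (\<forall>i k. i < k \<and> k < dim_row A \<and> zero_row A i \<longrightarrow> zero_row A k) \<and>
     (\<forall>i<dim_row A. \<not> zero_row A i \<longrightarrow> A $$ (i, lead_pos A i) = 1) \<and>
     (\<forall>i k. i < k \<and> k < dim_row A \<and> \<not> zero_row A i \<and> \<not> zero_row A k \<longrightarrow>
        lead_pos A i < lead_pos A k) \<and>
     (\<forall>i<dim_row A. \<not> zero_row A i \<longrightarrow>
        (\<forall>k<dim_row A. k \<noteq> i \<longrightarrow> A $$ (k, lead_pos A i) = 0))"

definition row_echelon_matrices :: "nat \<Rightarrow> 'a :: division_ring mat set" where
  "row_echelon_matrices n = {A \<in> carrier_mat n n. row_reduced_echelon A}"

text \<open>Transposition only interchanges the roles of rows and columns here: all conditions are on
  single entries, so non-commutativity does not matter.\<close>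

definition col_echelon_matrices :: "nat \<Rightarrow> 'a :: division_ring mat set" where
  "col_echelon_matrices m = {A \<in> carrier_mat m m. row_reduced_echelon (transpose_mat A)}"

text \<open>Joins and meets are the unique reduced echelon matrices with the indicated row or column
  space; existence and uniqueness are not built into the definite descriptions.\<close>

definition Rlat :: "nat \<Rightarrow> 'a :: division_ring mat lattice_ops" where
  "Rlat n =
     \<lparr> elems = row_echelon_matrices n,
       lub = (\<lambda>R1 R2. THE R. R \<in> row_echelon_matrices n \<and> LRS R = LRS R1 + LRS R2),
       glb = (\<lambda>R1 R2. THE R. R \<in> row_echelon_matrices n \<and> LRS R = LRS R1 \<inter> LRS R2) \<rparr>"

definition Clat :: "nat \<Rightarrow> 'a :: division_ring mat lattice_ops" where
  "Clat m =
     \<lparr> elems = col_echelon_matrices m,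
       lub = (\<lambda>C1 C2. THE C. C \<in> col_echelon_matrices m \<and> RCS C = RCS C1 + RCS C2),
       glb = (\<lambda>C1 C2. THE C. C \<in> col_echelon_matrices m \<and> RCS C = RCS C1 \<inter> RCS C2) \<rparr>"

end

theory Submission
  imports Defs
begin

text \<open>
  A left submodule of \<open>M\<^bsub>m\<times>n\<^esub>(D)\<close> consists of all matrices whose rows lie in a fixed
  left subspace of \<open>D\<^sub>n\<close>: multiplying by matrix units isolates and moves single rows. Every such
  subspace \<open>V\<close> is the row space of a unique reduced echelon matrix. Its leading columns are the
  pivots of \<open>V\<close>, i.e. the positions of the first nonzero entries of vectors of \<open>V\<close>, and its rows are
  the unique elements of \<open>V\<close> that restrict to unit vectors on the pivots; uniqueness holds
  because an element of \<open>V\<close> vanishing on all pivots is zero. The matrices with all rows in the row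
  space of \<open>R\<close> are the products \<open>X R\<close>. The statement on right submodules is the one on left
  submodules over the opposite division ring, via transposition.
\<close>


section \<open>Left submodules of matrices\<close>

lemma index_mult_mat_sum:
  assumes "A \<in> carrier_mat m k" "B \<in> carrier_mat k n" "i < m" "j < n"
  shows "(A * B) $$ (i, j) = (\<Sum>l<k. A $$ (i, l) * B $$ (l, j))"
  using assms by (auto simp: scalar_prod_def lessThan_atLeast0 intro!: sum.cong)

lemma left_submodulesD:
  assumes "I \<in> left_submodules m n"
  shows "X \<in> I \<Longrightarrow> X \<in> carrier_mat m n" "0\<^sub>m m n \<in> I"
    "X \<in> I \<Longrightarrow> Y \<in> I \<Longrightarrow> X + Y \<in> I"
    "A \<in> carrier_mat m m \<Longrightarrow> X \<in> I \<Longrightarrow> A * X \<in> I"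
  using assms by (auto simp: left_submodules_def)

text \<open>Scaling by \<open>c\<close> on the left is multiplication by the square matrix
  \<open>c \<cdot>\<^sub>m 1\<^sub>m m\<close>. For \<open>m = 1\<close> this makes
  \<open>left_submodules 1 n\<close> the set of left subspaces of the row vectors.\<close>

lemma left_submodules_smult:
  assumes "I \<in> left_submodules m n" "X \<in> I"
  shows "c \<cdot>\<^sub>m X \<in> I"
proof -
  have X: "X \<in> carrier_mat m n"
    using assms left_submodulesD by blast
  have "c \<cdot>\<^sub>m X = (c \<cdot>\<^sub>m 1\<^sub>m m) * X"
  proof (rule eq_matI)
    fix i j assume "i < dim_row (c \<cdot>\<^sub>m 1\<^sub>m m * X)" "j < dim_col (c \<cdot>\<^sub>m 1\<^sub>m m * X)"
    then have ij: "i < m" "j < n"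
      using X by auto
    have "(c \<cdot>\<^sub>m 1\<^sub>m m * X) $$ (i, j) = (\<Sum>l<m. (c \<cdot>\<^sub>m 1\<^sub>m m) $$ (i, l) * X $$ (l, j))"
      using X ij by (intro index_mult_mat_sum) auto
    also have "\<dots> = (\<Sum>l<m. if l = i then c * X $$ (i, j) else 0)"
      using ij by (intro sum.cong) auto
    finally show "(c \<cdot>\<^sub>m X) $$ (i, j) = (c \<cdot>\<^sub>m 1\<^sub>m m * X) $$ (i, j)"
      using X ij by simp
  qed (use X in auto)
  then show ?thesis
    using assms left_submodulesD(4)[of I m n "c \<cdot>\<^sub>m 1\<^sub>m m" X] by simp
qed

text \<open>The combination is written entrywise because row spaces and rows of matrix products both
  arise in this shape.\<close>

lemma left_submodules_lincomb:
  assumes V: "V \<in> left_submodules 1 n" and "finite S" "\<And>i. i \<in> S \<Longrightarrow> w i \<in> V"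
  shows "mat 1 n (\<lambda>(_, j). \<Sum>i\<in>S. c i * w i $$ (0, j)) \<in> V"
  using assms(2,3)
proof (induction S rule: finite_induct)
  case empty
  have "mat 1 n (\<lambda>(_, j). \<Sum>i\<in>{}. c i * w i $$ (0, j)) = 0\<^sub>m 1 n"
    by (rule eq_matI) auto
  then show ?case
    using left_submodulesD(2)[OF V] by (simp only:)
next
  case (insert a S)
  have a: "w a \<in> carrier_mat 1 n"
    using insert.prems left_submodulesD(1)[OF V] by blast
  have "mat 1 n (\<lambda>(_, j). \<Sum>i\<in>insert a S. c i * w i $$ (0, j))
      = c a \<cdot>\<^sub>m w a + mat 1 n (\<lambda>(_, j). \<Sum>i\<in>S. c i * w i $$ (0, j))"
    by (rule eq_matI) (use insert.hyps a in auto)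
  then show ?case
    using insert left_submodulesD(3)[OF V left_submodules_smult[OF V]] by simp
qed

lemma left_submodules_diff:
  assumes "I \<in> left_submodules m n" "X \<in> I" "Y \<in> I"
  shows "X - Y \<in> I"
proof -
  have "X \<in> carrier_mat m n" "Y \<in> carrier_mat m n"
    using assms left_submodulesD(1) by blast+
  then have "X - Y = X + (- 1) \<cdot>\<^sub>m Y"
    by (intro eq_matI) auto
  then show ?thesis
    using assms left_submodulesD(3) left_submodules_smult by metis
qed

lemma LRS_in_left_submodules:
  assumes "A \<in> carrier_mat m n"
  shows "LRS A \<in> left_submodules 1 n"
  unfolding left_submodules_def mem_Collect_eq
proof (intro conjI ballI)
  show "LRS A \<subseteq> carrier_mat 1 n"
    using assms by (auto simp: LRS_def)
  have "0\<^sub>m 1 n = mat 1 (dim_col A) (\<lambda>(_, j). \<Sum>i<dim_row A. 0 * A $$ (i, j))"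
    using assms by (intro eq_matI) auto
  then show "0\<^sub>m 1 n \<in> LRS A"
    unfolding LRS_def mem_Collect_eq by (intro exI[of _ "\<lambda>_. 0"]) simp
next
  fix u v assume "u \<in> LRS A" "v \<in> LRS A"
  then obtain c d where uv: "u = mat 1 (dim_col A) (\<lambda>(_, j). \<Sum>i<dim_row A. c i * A $$ (i, j))"
    "v = mat 1 (dim_col A) (\<lambda>(_, j). \<Sum>i<dim_row A. d i * A $$ (i, j))"
    unfolding LRS_def by blast
  have "u + v = mat 1 (dim_col A) (\<lambda>(_, j). \<Sum>i<dim_row A. (c i + d i) * A $$ (i, j))"
    unfolding uv by (intro eq_matI) (auto simp: distrib_right sum.distrib)
  then show "u + v \<in> LRS A"
    unfolding LRS_def by (intro CollectI exI[of _ "\<lambda>i. c i + d i"]) simp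
next
  fix B v :: "'a mat" assume B: "B \<in> carrier_mat 1 1" and "v \<in> LRS A"
  then obtain c where v: "v = mat 1 (dim_col A) (\<lambda>(_, j). \<Sum>i<dim_row A. c i * A $$ (i, j))"
    unfolding LRS_def by blast
  have "B * v = mat 1 (dim_col A) (\<lambda>(_, j). \<Sum>i<dim_row A. (B $$ (0, 0) * c i) * A $$ (i, j))"
    unfolding v using B
    by (intro eq_matI) (auto simp: scalar_prod_def sum_distrib_left mult.assoc)
  then show "B * v \<in> LRS A"
    unfolding LRS_def by (intro CollectI exI[of _ "\<lambda>i. B $$ (0, 0) * c i"]) simp
qed

lemma row_in_LRS:
  assumes "A \<in> carrier_mat m n" "i < m"
  shows "mat_of_row (row A i) \<in> LRS A"
proof -
  have *: "(\<Sum>k<m. (if k = i then 1 else 0) * A $$ (k, j)) = A $$ (i, j)" for j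
  proof -
    have "(\<Sum>k<m. (if k = i then 1 else 0) * A $$ (k, j)) = (\<Sum>k<m. if k = i then A $$ (i, j) else 0)"
      by (intro sum.cong) auto
    then show ?thesis
      using assms by simp
  qed
  have "mat_of_row (row A i)
      = mat 1 (dim_col A) (\<lambda>(_, j). \<Sum>k<dim_row A. (if k = i then 1 else 0) * A $$ (k, j))"
    using assms by (intro eq_matI) (auto simp: *)
  then show ?thesis
    unfolding LRS_def by (intro CollectI exI[of _ "\<lambda>k. if k = i then 1 else 0"]) simp
qed

section \<open>Reduced echelon matrices and row spaces\<close>

text \<open>Pivots are attached to the subspace rather than to a matrix spanning it, so that two
  echelon matrices with the same row space can be compared through them.\<close>

definition pivots :: "'a :: division_ring mat set \<Rightarrow> nat set" where
  "pivots V = {j. \<exists>v\<in>V. j < dim_col v \<and> v $$ (0, j) \<noteq> 0 \<and> (\<forall>k<j. v $$ (0, k) = 0)}"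

lemma pivots_subset:
  assumes "V \<in> left_submodules 1 n"
  shows "pivots V \<subseteq> {..<n}"
  using left_submodulesD(1)[OF assms] unfolding pivots_def by fastforce

text \<open>The position of the first nonzero entry of a nonzero \<open>v\<close> would itself be a
  pivot.\<close>

lemma zero_if_zero_on_pivots:
  assumes V: "V \<in> left_submodules 1 n" and v: "v \<in> V"
    and 0: "\<And>p. p \<in> pivots V \<Longrightarrow> v $$ (0, p) = 0" and j: "j < n"
  shows "v $$ (0, j) = 0"
proof (rule ccontr)
  assume nz: "v $$ (0, j) \<noteq> 0"
  \<comment> \<open>The minimum is taken over all naturals; being at most \<open>j\<close>, it is a
    genuine column index below \<open>n\<close>.\<close>
  define p where "p = (LEAST j. v $$ (0, j) \<noteq> 0)"
  have "v $$ (0, p) \<noteq> 0" "p \<le> j"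
    unfolding p_def using nz by (rule LeastI, rule Least_le)
  moreover have "v $$ (0, k) = 0" if "k < p" for k
    using not_less_Least[OF that[unfolded p_def]] by simp
  moreover have "v \<in> carrier_mat 1 n"
    using left_submodulesD(1)[OF V v] .
  ultimately have "p \<in> pivots V"
    using v j unfolding pivots_def by (intro CollectI bexI[of _ v]) auto
  then show False
    using 0 \<open>v $$ (0, p) \<noteq> 0\<close> by blast
qed

lemma eq_if_eq_on_pivots:
  assumes V: "V \<in> left_submodules 1 n" and uv: "u \<in> V" "v \<in> V"
    and eq: "\<And>p. p \<in> pivots V \<Longrightarrow> u $$ (0, p) = v $$ (0, p)"
  shows "u = v"
proof -
  have uv_carrier: "u \<in> carrier_mat 1 n" "v \<in> carrier_mat 1 n"
    using left_submodulesD(1)[OF V] uv by auto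
  have "(u - v) $$ (0, j) = 0" if "j < n" for j
    using V left_submodules_diff[OF V uv] _ that
  proof (rule zero_if_zero_on_pivots)
    fix p assume "p \<in> pivots V"
    then show "(u - v) $$ (0, p) = 0"
      using eq pivots_subset[OF V] uv_carrier by auto
  qed
  then show ?thesis
    using uv_carrier by (intro eq_matI) auto
qed

text \<open>Back substitution, from the last pivot to the first: a vector with leading position
  \<open>p\<close> is normalised and then cleared at the later pivots by their reduced rows. The
  vanishing before \<open>p\<close> is carried through the induction, since it ensures that clearing
  leaves the entries up to \<open>p\<close> alone.\<close>

lemma reduced_row_exists:
  assumes V: "V \<in> left_submodules 1 n" and "p \<in> pivots V"
  shows "\<exists>v\<in>V. (\<forall>q\<in>pivots V. v $$ (0, q) = (if q = p then 1 else 0)) \<and> (\<forall>k<p. v $$ (0, k) = 0)"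
  using assms(2)
proof (induction p rule: measure_induct_rule[where f = "\<lambda>p. n - p"])
  case (less p)
  define Q where "Q = {q \<in> pivots V. p < q}"
  have pn: "p < n" and fin: "finite Q"
    using less.prems pivots_subset[OF V] finite_subset[of Q "{..<n}"] by (auto simp: Q_def)
  have "\<forall>q\<in>Q. \<exists>v. v \<in> V \<and> (\<forall>r\<in>pivots V. v $$ (0, r) = (if r = q then 1 else 0))
      \<and> (\<forall>k<q. v $$ (0, k) = 0)"
  proof
    fix q assume "q \<in> Q"
    then have "n - q < n - p" "q \<in> pivots V"
      using pn by (auto simp: Q_def)
    from less.IH[OF this] show "\<exists>v. v \<in> V \<and> (\<forall>r\<in>pivots V. v $$ (0, r) = (if r = q then 1 else 0))
      \<and> (\<forall>k<q. v $$ (0, k) = 0)"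
      by blast
  qed
  then obtain w where w: "\<And>q. q \<in> Q \<Longrightarrow> w q \<in> V"
    "\<And>q r. q \<in> Q \<Longrightarrow> r \<in> pivots V \<Longrightarrow> w q $$ (0, r) = (if r = q then 1 else 0)"
    "\<And>q k. q \<in> Q \<Longrightarrow> k < q \<Longrightarrow> w q $$ (0, k) = 0"
    by metis
  obtain v0 where v0: "v0 \<in> V" "v0 $$ (0, p) \<noteq> 0" "\<And>k. k < p \<Longrightarrow> v0 $$ (0, k) = 0"
    using less.prems unfolding pivots_def by blast
  \<comment> \<open>Scalars act from the left, so the left inverse of the leading entry turns it
    into 1.\<close>
  define u where "u = inverse (v0 $$ (0, p)) \<cdot>\<^sub>m v0"
  have u: "u \<in> V"
    unfolding u_def by (rule left_submodules_smult[OF V v0(1)])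
  have v0c: "v0 \<in> carrier_mat 1 n"
    using left_submodulesD(1)[OF V v0(1)] .
  have up: "u $$ (0, p) = 1" and u0: "\<And>k. k < p \<Longrightarrow> u $$ (0, k) = 0" and uc: "u \<in> carrier_mat 1 n"
    using v0 v0c pn by (auto simp: u_def)
  \<comment> \<open>On the pivots each \<open>w q\<close> is a unit vector, so the coefficients that
    clear \<open>u\<close> at the later pivots are the entries of \<open>u\<close> there.\<close>
  define s where "s = mat 1 n (\<lambda>(_, j). \<Sum>q\<in>Q. u $$ (0, q) * w q $$ (0, j))"
  have s: "s \<in> V"
    unfolding s_def by (intro left_submodules_lincomb V fin w)
  have ss: "s $$ (0, j) = (\<Sum>q\<in>Q. u $$ (0, q) * w q $$ (0, j))" if "j < n" for j
    using that by (simp add: s_def)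
  have s_low: "s $$ (0, k) = 0" if "k < p" for k
    using that pn w(3) by (subst ss) (auto simp: Q_def intro!: sum.neutral)
  have s_piv: "s $$ (0, r) = (if r \<in> Q then u $$ (0, r) else 0)" if "r \<in> pivots V" for r
  proof -
    have "(\<Sum>q\<in>Q. u $$ (0, q) * w q $$ (0, r)) = (\<Sum>q\<in>Q. if q = r then u $$ (0, r) else 0)"
      using w(2) that by (intro sum.cong) auto
    then show ?thesis
      using that pivots_subset[OF V] fin by (subst ss) auto
  qed
  have idx: "(u - s) $$ (0, j) = u $$ (0, j) - s $$ (0, j)" if "j < n" for j
    using that uc by (simp add: s_def)
  show ?case
  proof (intro bexI[of _ "u - s"] conjI ballI allI impI)
    show "u - s \<in> V"
      by (rule left_submodules_diff[OF V u s])
  next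
    fix q assume q: "q \<in> pivots V"
    then have "q < n"
      using pivots_subset[OF V] by auto
    consider "q < p" | "q = p" | "q \<in> Q"
      using q by (fastforce simp: Q_def)
    then show "(u - s) $$ (0, q) = (if q = p then 1 else 0)"
      using s_piv[OF q] up u0 idx[OF \<open>q < n\<close>] by cases (auto simp: Q_def)
  next
    fix k assume "k < p"
    then show "(u - s) $$ (0, k) = 0"
      using idx pn u0 s_low by simp
  qed
qed

section \<open>Existence of an echelon matrix with a prescribed row space\<close>

lemma lead_posI:
  assumes "j < dim_col A" "A $$ (i, j) \<noteq> 0" "\<And>k. k < j \<Longrightarrow> A $$ (i, k) = 0"
  shows "\<not> zero_row A i" "lead_pos A i = j"
proof -
  show "\<not> zero_row A i"
    using assms by (auto simp: zero_row_def)
  show "lead_pos A i = j"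
    unfolding lead_pos_def using assms by (intro Least_equality) (auto simp: not_less[symmetric])
qed

lemma lead_pos_props:
  assumes "\<not> zero_row A i"
  shows "lead_pos A i < dim_col A" "A $$ (i, lead_pos A i) \<noteq> 0"
    "\<And>k. k < lead_pos A i \<Longrightarrow> A $$ (i, k) = 0"
proof -
  have "\<exists>j. j < dim_col A \<and> A $$ (i, j) \<noteq> 0"
    using assms by (auto simp: zero_row_def)
  from LeastI_ex[OF this, folded lead_pos_def]
  show *: "lead_pos A i < dim_col A" "A $$ (i, lead_pos A i) \<noteq> 0"
    by auto
  fix k assume "k < lead_pos A i"
  then show "A $$ (i, k) = 0"
    using not_less_Least[of k "\<lambda>j. j < dim_col A \<and> A $$ (i, j) \<noteq> 0"] * by (auto simp: lead_pos_def)
qed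

text \<open>The reduced rows, listed by increasing pivot, form an echelon matrix. They span
  \<open>V\<close> because a vector of \<open>V\<close> and the combination of rows weighted by its
  own pivot entries agree on all pivots.\<close>

lemma row_echelon_exists:
  assumes V: "V \<in> left_submodules 1 n"
  shows "\<exists>R\<in>row_echelon_matrices n. LRS R = V"
proof -
  define P where "P = pivots V"
  define ps where "ps = sorted_list_of_set P"
  have P: "P \<subseteq> {..<n}" and fin: "finite P"
    using pivots_subset[OF V] finite_subset[of P "{..<n}"] by (auto simp: P_def)
  have set_ps: "set ps = P" and dist: "distinct ps" and len: "length ps = card P"
    and sorted: "sorted_wrt (<) ps"
    using fin by (auto simp: ps_def)
  have cardn: "card P \<le> n"
    using card_mono[OF _ P] by simp
  obtain w where w: "\<And>p. p \<in> P \<Longrightarrow> w p \<in> V"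
    "\<And>p q. p \<in> P \<Longrightarrow> q \<in> P \<Longrightarrow> w p $$ (0, q) = (if q = p then 1 else 0)"
    "\<And>p k. p \<in> P \<Longrightarrow> k < p \<Longrightarrow> w p $$ (0, k) = 0"
    using reduced_row_exists[OF V] unfolding P_def by metis
  \<comment> \<open>There are at most \<open>n\<close> pivots, so the reduced rows fit into a square
    matrix; the remaining rows are filled with zeros.\<close>
  define R where "R = mat n n (\<lambda>(i, j). if i < card P then w (ps ! i) $$ (0, j) else 0)"
  have R: "R \<in> carrier_mat n n"
    by (simp add: R_def)
  have psP: "ps ! i \<in> P" if "i < card P" for i
    using that set_ps len nth_mem by metis
  have psn: "ps ! i < n" if "i < card P" for i
    using psP[OF that] P by auto
  have entry: "R $$ (i, j) = (if i < card P then w (ps ! i) $$ (0, j) else 0)" if "i < n" "j < n" for i j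
    using that by (simp add: R_def)
  have inj: "ps ! i = ps ! k \<longleftrightarrow> i = k" if "i < card P" "k < card P" for i k
    using that dist len nth_eq_iff_index_eq by metis
  have nonzero: "\<not> zero_row R i" "lead_pos R i = ps ! i" if "i < card P" for i
    using lead_posI[of "ps ! i" R i] that psn[OF that] psP[OF that] cardn entry w R by auto
  have zero: "zero_row R i" if "card P \<le> i" "i < n" for i
    using that R by (auto simp: zero_row_def entry)
  have zero_iff: "zero_row R i \<longleftrightarrow> card P \<le> i" if "i < n" for i
    using that nonzero zero by (meson not_less)
  have piv: "R $$ (k, ps ! i) = (if k = i then 1 else 0)" if "i < card P" "k < n" for i k
    using that psn[OF that(1)] psP w(2) inj by (auto simp: entry)
  have "row_reduced_echelon R"
    unfolding row_reduced_echelon_def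
  proof (intro conjI allI impI)
    fix i k assume *: "i < k \<and> k < dim_row R \<and> \<not> zero_row R i \<and> \<not> zero_row R k"
    then have "i < k" "k < card P"
      using zero_iff R by auto
    then show "lead_pos R i < lead_pos R k"
      using nonzero(2) sorted len by (simp add: sorted_wrt_nth_less)
  qed (use R zero_iff nonzero piv cardn in \<open>auto simp: not_le\<close>)
  moreover have "LRS R = V"
  proof
    show "LRS R \<subseteq> V"
    proof
      fix v assume "v \<in> LRS R"
      then obtain c where "v = mat 1 n (\<lambda>(_, j). \<Sum>i<n. c i * R $$ (i, j))"
        using R unfolding LRS_def by auto
      \<comment> \<open>Padding rows are read as the zero vector, so that every vector in the
        combination belongs to \<open>V\<close>.\<close>
      also have "\<dots> = mat 1 n (\<lambda>(_, j). \<Sum>i<n. c i * (if i < card P then w (ps ! i) else 0\<^sub>m 1 n) $$ (0, j))"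
        by (intro eq_matI) (auto simp: entry intro!: sum.cong)
      also have "\<dots> \<in> V"
        using w(1) psP left_submodulesD(2)[OF V] by (intro left_submodules_lincomb[OF V]) auto
      finally show "v \<in> V" .
    qed
    show "V \<subseteq> LRS R"
    proof
      fix v assume v: "v \<in> V"
      \<comment> \<open>The candidate combination: row \<open>i\<close> is weighted by the entry of
        \<open>v\<close> at the \<open>i\<close>-th pivot.\<close>
      define u where "u = mat 1 n (\<lambda>(_, j). \<Sum>i<n. (if i < card P then v $$ (0, ps ! i) else 0) * R $$ (i, j))"
      have u: "u \<in> LRS R"
        using R unfolding LRS_def u_def
        by (intro CollectI exI[of _ "\<lambda>i. if i < card P then v $$ (0, ps ! i) else 0"]) auto
      have "v = u"
        using V v
      proof (rule eq_if_eq_on_pivots)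
        show "u \<in> V"
          using u \<open>LRS R \<subseteq> V\<close> by blast
        fix p assume "p \<in> pivots V"
        then obtain k where k: "k < card P" "p = ps ! k"
          using set_ps len by (metis P_def in_set_conv_nth)
        have "u $$ (0, p) = (\<Sum>i<n. (if i < card P then v $$ (0, ps ! i) else 0) * R $$ (i, p))"
          using k psn by (simp add: u_def)
        also have "\<dots> = (\<Sum>i<n. if i = k then v $$ (0, p) else 0)"
          using k piv by (intro sum.cong) auto
        finally show "v $$ (0, p) = u $$ (0, p)"
          using k cardn by simp
      qed
      then show "v \<in> LRS R"
        using u by simp
    qed
  qed
  ultimately show ?thesis
    using R unfolding row_echelon_matrices_def by blast
qed

text \<open>A nonzero row witnesses its own leading position. Conversely, let a combination of rows
  have its first nonzero entry in a column \<open>j\<close> that is no leading column. Rows leading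
  before \<open>j\<close> have coefficient 0, as the combination vanishes there; rows leading after
  \<open>j\<close> vanish at \<open>j\<close>. So the entry at \<open>j\<close> would be 0.\<close>

lemma pivots_LRS:
  assumes "R \<in> row_echelon_matrices n"
  shows "pivots (LRS R) = lead_pos R ` {i. i < n \<and> \<not> zero_row R i}"
proof
  have R: "R \<in> carrier_mat n n" "row_reduced_echelon R"
    using assms by (auto simp: row_echelon_matrices_def)
  show "lead_pos R ` {i. i < n \<and> \<not> zero_row R i} \<subseteq> pivots (LRS R)"
  proof clarify
    fix i assume i: "i < n" "\<not> zero_row R i"
    from lead_pos_props[OF i(2)] row_in_LRS[OF R(1) i(1)] R(1) i(1)
    show "lead_pos R i \<in> pivots (LRS R)"
      unfolding pivots_def by (intro CollectI bexI[of _ "mat_of_row (row R i)"]) auto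
  qed
  show "pivots (LRS R) \<subseteq> lead_pos R ` {i. i < n \<and> \<not> zero_row R i}"
  proof
    fix j assume "j \<in> pivots (LRS R)"
    then obtain v where v: "v \<in> LRS R" "j < dim_col v" "v $$ (0, j) \<noteq> 0" "\<And>k. k < j \<Longrightarrow> v $$ (0, k) = 0"
      unfolding pivots_def by blast
    then obtain c where c: "v = mat 1 n (\<lambda>(_, j). \<Sum>i<n. c i * R $$ (i, j))"
      using R unfolding LRS_def by auto
    have jn: "j < n"
      using v(2) c by simp
    \<comment> \<open>A leading column contains a single 1 and zeros elsewhere, so the combination
      displays the coefficient of row \<open>i\<close> in that column.\<close>
    have vl: "v $$ (0, lead_pos R i) = c i" if i: "i < n" "\<not> zero_row R i" for i
    proof -
      have "(\<Sum>k<n. c k * R $$ (k, lead_pos R i)) = (\<Sum>k<n. if k = i then c i else 0)"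
        using R i by (intro sum.cong) (auto simp: row_reduced_echelon_def)
      then show ?thesis
        using c lead_pos_props(1)[OF i(2)] R(1) i by simp
    qed
    show "j \<in> lead_pos R ` {i. i < n \<and> \<not> zero_row R i}"
    proof (rule ccontr)
      assume nj: "j \<notin> lead_pos R ` {i. i < n \<and> \<not> zero_row R i}"
      have "c i * R $$ (i, j) = 0" if i: "i < n" for i
      proof (cases "zero_row R i")
        case True
        then show ?thesis
          using jn R by (auto simp: zero_row_def)
      next
        case False
        then have "lead_pos R i \<noteq> j"
          using nj i by blast
        then consider "lead_pos R i < j" | "j < lead_pos R i"
          by linarith
        then show ?thesis
          using vl[OF i False] v(4) lead_pos_props(3)[OF False] by cases auto
      qed
      then have "(\<Sum>i<n. c i * R $$ (i, j)) = 0"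
        by (intro sum.neutral) blast
      then have "v $$ (0, j) = 0"
        using c jn by simp
      then show False
        using v(3) by blast
    qed
  qed
qed

text \<open>As zero rows come last, the nonzero rows form an initial segment, and their strictly
  increasing leading positions enumerate the pivots in order. Hence the number of nonzero rows and
  all leading positions depend on the row space alone.\<close>

lemma row_echelon_lead_pos:
  assumes "R \<in> row_echelon_matrices n" "i < n"
  shows "zero_row R i \<longleftrightarrow> card (pivots (LRS R)) \<le> i"
    "\<not> zero_row R i \<Longrightarrow> lead_pos R i = sorted_list_of_set (pivots (LRS R)) ! i"
proof -
  have R: "R \<in> carrier_mat n n" "row_reduced_echelon R"
    using assms by (auto simp: row_echelon_matrices_def)
  define N where "N = {i. i < n \<and> \<not> zero_row R i}"
  have "N \<subseteq> {..<n}" "finite N"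
    by (auto simp: N_def)
  have down: "i \<in> N" if "k \<in> N" "i < k" for i k
    using that R by (auto simp: N_def row_reduced_echelon_def)
  obtain r where N: "N = {..<r}"
  \<comment> \<open>A finite set of indices closed downwards is an initial segment: \<open>r\<close>
    is one more than its maximum, or 0 if it is empty.\<close>
  proof (cases "N = {}")
    case False
    have "N = {..<Suc (Max N)}"
    proof (intro equalityI subsetI)
      fix x assume "x \<in> {..<Suc (Max N)}"
      then show "x \<in> N"
        using down[OF Max_in[OF \<open>finite N\<close> False]] Max_in[OF \<open>finite N\<close> False]
        by (cases "x = Max N") auto
    qed (use \<open>finite N\<close> in \<open>auto simp: less_Suc_eq_le\<close>)
    then show ?thesis
      using that by blast
  qed (use that[of 0] in simp)
  have mono: "strict_mono_on N (lead_pos R)"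
    using R by (auto simp: strict_mono_on_def N_def row_reduced_echelon_def)
  then have card: "card (pivots (LRS R)) = r"
    unfolding pivots_LRS[OF assms(1)] N_def[symmetric]
    using card_image[OF strict_mono_on_imp_inj_on] N by fastforce
  have zero_row_iff: "\<not> zero_row R i \<longleftrightarrow> i < r"
    using assms(2) N unfolding N_def by blast
  show "zero_row R i \<longleftrightarrow> card (pivots (LRS R)) \<le> i"
    using zero_row_iff card by auto
  have list: "map (lead_pos R) [0..<r] = sorted_list_of_set (pivots (LRS R))"
  proof (rule strict_sorted_equal)
    show "sorted_wrt (<) (map (lead_pos R) [0..<r])"
      using mono N by (auto simp: sorted_wrt_iff_nth_less strict_mono_on_def)
    show "set (map (lead_pos R) [0..<r]) = set (sorted_list_of_set (pivots (LRS R)))"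
      using N \<open>finite N\<close> unfolding pivots_LRS[OF assms(1)] N_def[symmetric]
      by (simp add: lessThan_atLeast0)
  qed (simp_all)
  assume "\<not> zero_row R i"
  then have "i < r"
    using zero_row_iff by simp
  with list[symmetric] show "lead_pos R i = sorted_list_of_set (pivots (LRS R)) ! i"
    by simp
qed

text \<open>The row space fixes which rows are nonzero and where they lead. Corresponding nonzero
  rows then restrict to the same unit vector on the pivots, and both lie in the common row
  space.\<close>

lemma row_echelon_unique:
  assumes R: "R \<in> row_echelon_matrices n" and S: "S \<in> row_echelon_matrices n" and eq: "LRS R = LRS S"
  shows "R = S"
proof -
  have c: "R \<in> carrier_mat n n" "S \<in> carrier_mat n n"
    and rre: "row_reduced_echelon R" "row_reduced_echelon S"
    using R S by (auto simp: row_echelon_matrices_def)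
  have V: "LRS R \<in> left_submodules 1 n"
    using LRS_in_left_submodules c by blast
  have "R $$ (i, j) = S $$ (i, j)" if ij: "i < n" "j < n" for i j
  proof (cases "zero_row R i")
    case True
    then have "zero_row S i"
      using row_echelon_lead_pos(1) R S ij eq by metis
    then show ?thesis
      using True c ij by (auto simp: zero_row_def)
  next
    case False
    then have False': "\<not> zero_row S i"
      using row_echelon_lead_pos(1) R S ij eq by metis
    have lead: "lead_pos R i = lead_pos S i"
      using row_echelon_lead_pos(2) R S ij eq False False' by metis
    \<comment> \<open>Every pivot is the leading position of some row. If that row is another one,
      its leading column has a zero in row \<open>i\<close>.\<close>
    have unit: "A $$ (i, p) = (if p = lead_pos A i then 1 else 0)"
      if A: "A \<in> row_echelon_matrices n" "\<not> zero_row A i" "p \<in> pivots (LRS A)" for A :: "'a mat" and p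
      using A ij unfolding pivots_LRS[OF A(1)]
      by (auto simp: row_echelon_matrices_def row_reduced_echelon_def) metis
    have "mat_of_row (row R i) = mat_of_row (row S i)"
      using V
    proof (rule eq_if_eq_on_pivots)
      fix p assume p: "p \<in> pivots (LRS R)"
      then have "p < n"
        using pivots_subset[OF V] by auto
      then show "mat_of_row (row R i) $$ (0, p) = mat_of_row (row S i) $$ (0, p)"
        using unit[OF R False] unit[OF S False'] p eq lead c ij by simp
    qed (use row_in_LRS[OF c(1) ij(1)] row_in_LRS[OF c(2) ij(1)] eq in auto)
    then have "mat_of_row (row R i) $$ (0, j) = mat_of_row (row S i) $$ (0, j)"
      by simp
    then show ?thesis
      using c ij by simp
  qed
  then show ?thesis
    using c by (intro eq_matI) auto
qed

lemma bij_betw_LRS: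
  "bij_betw LRS (row_echelon_matrices n) (left_submodules 1 n)"
  unfolding bij_betw_def
proof
  show "inj_on LRS (row_echelon_matrices n)"
    using row_echelon_unique by (auto simp: inj_on_def)
  have "LRS R \<in> left_submodules 1 n" if "R \<in> row_echelon_matrices n" for R :: "'a mat"
    using that LRS_in_left_submodules unfolding row_echelon_matrices_def by blast
  then show "LRS ` row_echelon_matrices n = (left_submodules 1 n :: 'a mat set set)"
    using row_echelon_exists by blast
qed


section \<open>Lattice isomorphisms\<close>

text \<open>A bijection compatible with the operations transports the lattice laws, so they are only
  checked on the source \<open>L\<close>.\<close>

lemma lattice_isoI:
  assumes L: "is_lattice L" and bij: "bij_betw \<phi> (elems L) (elems K)"
    and lub: "\<And>x y. x \<in> elems L \<Longrightarrow> y \<in> elems L \<Longrightarrow> \<phi> (lub L x y) = lub K (\<phi> x) (\<phi> y)"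
    and glb: "\<And>x y. x \<in> elems L \<Longrightarrow> y \<in> elems L \<Longrightarrow> \<phi> (glb L x y) = glb K (\<phi> x) (\<phi> y)"
  shows "lattice_iso \<phi> L K"
proof -
  have img: "elems K = \<phi> ` elems L"
    using bij by (auto simp: bij_betw_def)
  have laws: "lub L x y \<in> elems L" "glb L x y \<in> elems L" "lub L x y = lub L y x" "glb L x y = glb L y x"
    "lub L x (glb L x y) = x" "glb L x (lub L x y) = x"
    if "x \<in> elems L" "y \<in> elems L" for x y
    using L that unfolding is_lattice_def by blast+
  have assoc: "lub L (lub L x y) z = lub L x (lub L y z)" "glb L (glb L x y) z = glb L x (glb L y z)"
    if "x \<in> elems L" "y \<in> elems L" "z \<in> elems L" for x y z
    using L that unfolding is_lattice_def by blast+
  have "is_lattice K"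
    unfolding is_lattice_def img ball_simps
    by (intro conjI ballI)
      (simp_all add: lub[symmetric] glb[symmetric] laws(1,2,5,6) assoc, simp_all add: laws(3,4))
  then show ?thesis
    using assms unfolding lattice_iso_def by blast
qed

lemma lattice_iso_inv:
  assumes iso: "lattice_iso \<phi> L K"
  shows "lattice_iso (inv_into (elems L) \<phi>) K L"
proof (rule lattice_isoI)
  have bij: "bij_betw \<phi> (elems L) (elems K)" and inj: "inj_on \<phi> (elems L)"
    and img: "\<phi> ` elems L = elems K"
    using iso by (auto simp: lattice_iso_def bij_betw_def)
  have closed: "\<And>x y. x \<in> elems L \<Longrightarrow> y \<in> elems L \<Longrightarrow> lub L x y \<in> elems L \<and> glb L x y \<in> elems L"
    using iso unfolding lattice_iso_def is_lattice_def by blast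
  show "is_lattice K"
    using iso by (simp add: lattice_iso_def)
  show "bij_betw (inv_into (elems L) \<phi>) (elems K) (elems L)"
    using bij by (rule bij_betw_inv_into)
  fix x y assume "x \<in> elems K" "y \<in> elems K"
  then obtain a b where ab: "a \<in> elems L" "b \<in> elems L" "x = \<phi> a" "y = \<phi> b"
    using img by blast
  have "lub K x y = \<phi> (lub L a b)" "glb K x y = \<phi> (glb L a b)"
    using iso ab by (auto simp: lattice_iso_def)
  then show "inv_into (elems L) \<phi> (lub K x y) = lub L (inv_into (elems L) \<phi> x) (inv_into (elems L) \<phi> y)"
    "inv_into (elems L) \<phi> (glb K x y) = glb L (inv_into (elems L) \<phi> x) (inv_into (elems L) \<phi> y)"
    using ab closed inv_into_f_f[OF inj] by simp_all
qed

lemma lattice_iso_comp: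
  assumes "lattice_iso \<phi> L K" "lattice_iso \<psi> K M"
  shows "lattice_iso (\<psi> \<circ> \<phi>) L M"
proof (rule lattice_isoI)
  have "\<And>x. x \<in> elems L \<Longrightarrow> \<phi> x \<in> elems K"
    using assms(1) by (auto simp: lattice_iso_def bij_betw_def)
  then show "(\<psi> \<circ> \<phi>) (lub L x y) = lub M ((\<psi> \<circ> \<phi>) x) ((\<psi> \<circ> \<phi>) y)"
    "(\<psi> \<circ> \<phi>) (glb L x y) = glb M ((\<psi> \<circ> \<phi>) x) ((\<psi> \<circ> \<phi>) y)"
    if "x \<in> elems L" "y \<in> elems L" for x y
    using assms that by (auto simp: lattice_iso_def)
qed (use assms in \<open>auto simp: lattice_iso_def intro: bij_betw_trans\<close>)

text \<open>Allows a map built from \<open>inv_into\<close> to be replaced by an explicit one that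
  agrees with it on the carrier.\<close>

lemma lattice_iso_cong:
  assumes iso: "lattice_iso \<phi> L K" and eq: "\<And>x. x \<in> elems L \<Longrightarrow> \<phi> x = \<psi> x"
  shows "lattice_iso \<psi> L K"
proof (rule lattice_isoI)
  show L: "is_lattice L"
    using iso by (simp add: lattice_iso_def)
  show "bij_betw \<psi> (elems L) (elems K)"
    using iso eq bij_betw_cong[of "elems L" \<phi> \<psi>] by (simp add: lattice_iso_def)
  fix x y assume xy: "x \<in> elems L" "y \<in> elems L"
  then have "lub L x y \<in> elems L" "glb L x y \<in> elems L"
    using L unfolding is_lattice_def by blast+
  then show "\<psi> (lub L x y) = lub K (\<psi> x) (\<psi> y)" "\<psi> (glb L x y) = glb K (\<psi> x) (\<psi> y)"
    using iso xy by (simp_all add: eq[symmetric] lattice_iso_def)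
qed

text \<open>The record has the shape of \<open>Rlat\<close> and \<open>Clat\<close>. Bijectivity of
  \<open>F\<close> provides existence and uniqueness for the definite descriptions, so the
  operations are those of \<open>L\<close> pulled back along \<open>F\<close>, and the lattice laws
  come for free.\<close>

lemma lattice_iso_THE:
  assumes L: "is_lattice L" and bij: "bij_betw F E (elems L)"
  shows "lattice_iso F
    \<lparr>elems = E, lub = (\<lambda>x y. THE z. z \<in> E \<and> F z = lub L (F x) (F y)),
      glb = (\<lambda>x y. THE z. z \<in> E \<and> F z = glb L (F x) (F y))\<rparr> L"
    (is "lattice_iso F ?K L")
proof -
  have inj: "inj_on F E" and img: "F ` E = elems L"
    using bij by (auto simp: bij_betw_def)
  have closed: "\<And>x y. x \<in> elems L \<Longrightarrow> y \<in> elems L \<Longrightarrow> lub L x y \<in> elems L \<and> glb L x y \<in> elems L"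
    using L unfolding is_lattice_def by blast
  have the: "(THE z. z \<in> E \<and> F z = a) = inv_into E F a" if "a \<in> elems L" for a
  proof (rule the_equality)
    show "inv_into E F a \<in> E \<and> F (inv_into E F a) = a"
      using that img by (auto simp: inv_into_into f_inv_into_f)
  qed (use inj in auto)
  \<comment> \<open>The inverse of \<open>F\<close> comes first: \<open>lattice_isoI\<close> wants
    the source to be a lattice, and this is known of \<open>L\<close> only.\<close>
  have "lattice_iso (inv_into E F) L ?K"
  proof (rule lattice_isoI)
    fix x y assume xy: "x \<in> elems L" "y \<in> elems L"
    then have "F (inv_into E F x) = x" "F (inv_into E F y) = y"
      using img by (auto simp: f_inv_into_f)
    then show "inv_into E F (lub L x y) = lub ?K (inv_into E F x) (inv_into E F y)"
      "inv_into E F (glb L x y) = glb ?K (inv_into E F x) (inv_into E F y)"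
      using closed[OF xy] the by simp_all
  qed (use L bij_betw_inv_into[OF bij] in simp_all)
  from lattice_iso_inv[OF this] have "lattice_iso (inv_into (elems L) (inv_into E F)) ?K L" .
  moreover have "inv_into (elems L) (inv_into E F) x = F x" if "x \<in> elems ?K" for x
    using that bij by (simp add: inv_into_inv_into_eq)
  ultimately show ?thesis
    by (rule lattice_iso_cong)
qed

section \<open>The lattice of left submodules\<close>

lemma set_plus_mat_iff: "X \<in> (I + J :: 'a :: plus mat set) \<longleftrightarrow> (\<exists>A\<in>I. \<exists>B\<in>J. X = A + B)"
  by (auto simp: set_plus_def)

lemma left_submodules_plus:
  fixes I J :: "'a :: division_ring mat set"
  assumes I: "I \<in> left_submodules m n" and J: "J \<in> left_submodules m n"
  shows "I + J \<in> left_submodules m n"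
  unfolding left_submodules_def mem_Collect_eq
proof (intro conjI ballI)
  note IJ = left_submodulesD[OF I] left_submodulesD[OF J]
  show "I + J \<subseteq> carrier_mat m n"
    using IJ(1,5) by (auto simp: set_plus_mat_iff)
  show "0\<^sub>m m n \<in> I + J"
    using IJ(2,6) left_add_zero_mat[OF zero_carrier_mat[of m n]] unfolding set_plus_mat_iff by metis
next
  note IJ = left_submodulesD[OF I] left_submodulesD[OF J]
  fix X Y assume "X \<in> I + J" "Y \<in> I + J"
  then obtain A B C D where *: "X = A + B" "Y = C + D" "A \<in> I" "C \<in> I" "B \<in> J" "D \<in> J"
    by (auto simp: set_plus_mat_iff)
  then have "A \<in> carrier_mat m n" "B \<in> carrier_mat m n" "C \<in> carrier_mat m n" "D \<in> carrier_mat m n"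
    using IJ(1,5) by auto
  then have "X + Y = (A + C) + (B + D)"
    unfolding * by (intro eq_matI) auto
  then show "X + Y \<in> I + J"
    using * IJ(3)[of A C] IJ(7)[of B D] unfolding set_plus_mat_iff by blast
next
  note IJ = left_submodulesD[OF I] left_submodulesD[OF J]
  fix A X :: "'a mat" assume A: "A \<in> carrier_mat m m" and "X \<in> I + J"
  then obtain B C where *: "X = B + C" "B \<in> I" "C \<in> J"
    by (auto simp: set_plus_mat_iff)
  then have "A * X = A * B + A * C"
    using A IJ(1)[of B] IJ(5)[of C] by (auto intro: mult_add_distrib_mat)
  then show "A * X \<in> I + J"
    using A * IJ(4)[of A B] IJ(8)[of A C] unfolding set_plus_mat_iff by blast
qed

text \<open>Commutativity and associativity of sums come from matrices of one fixed size. Absorption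
  holds since \<open>I\<close> lies in \<open>I + K\<close> when \<open>K\<close> contains 0, and
  \<open>I + (I \<inter> J)\<close> stays in \<open>I\<close> by closure under addition.\<close>

lemma is_lattice_LS: "is_lattice (LS m n :: 'a :: division_ring mat set lattice_ops)"
proof -
  have int: "I \<inter> J \<in> left_submodules m n"
    if "I \<in> left_submodules m n" "J \<in> left_submodules m n" for I J :: "'a mat set"
    using that by (auto simp: left_submodules_def)
  have comm: "I + J = J + I"
    if "I \<in> left_submodules m n" "J \<in> left_submodules m n" for I J :: "'a mat set"
    using that[THEN left_submodulesD(1)] comm_add_mat unfolding set_eq_iff set_plus_mat_iff by metis
  have assoc: "(I + J) + K = I + (J + K)"
    if "I \<in> left_submodules m n" "J \<in> left_submodules m n" "K \<in> left_submodules m n"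
    for I J K :: "'a mat set"
  proof -
    have eq: "(A + B) + C = A + (B + C)" if "A \<in> I" "B \<in> J" "C \<in> K" for A B C
      using that left_submodulesD(1) \<open>I \<in> _\<close> \<open>J \<in> _\<close> \<open>K \<in> _\<close> by (metis assoc_add_mat)
    show ?thesis
    proof (intro equalityI subsetI)
      fix X assume "X \<in> (I + J) + K"
      then obtain A B C where *: "A \<in> I" "B \<in> J" "C \<in> K" "X = (A + B) + C"
        by (auto elim!: set_plus_elim)
      show "X \<in> I + (J + K)"
        unfolding *(4) eq[OF *(1-3)] using * by (intro set_plus_intro)
    next
      fix X assume "X \<in> I + (J + K)"
      then obtain A B C where *: "A \<in> I" "B \<in> J" "C \<in> K" "X = A + (B + C)"
        by (auto elim!: set_plus_elim)
      show "X \<in> (I + J) + K"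
        unfolding *(4) eq[OF *(1-3), symmetric] using * by (intro set_plus_intro)
    qed
  qed
  have sub: "A \<in> I + K"
    if "I \<in> left_submodules m n" "K \<in> left_submodules m n" "A \<in> I" for A and I K :: "'a mat set"
    unfolding set_plus_mat_iff
    using right_add_zero_mat[OF left_submodulesD(1)[OF that(1,3)]]
      left_submodulesD(2)[OF that(2)] that(3)
    by (intro bexI[of _ A] bexI[of _ "0\<^sub>m m n"]) simp_all
  have absorb: "I + (I \<inter> J) = I \<and> I \<inter> (I + J) = I"
    if I: "I \<in> left_submodules m n" and J: "J \<in> left_submodules m n" for I J :: "'a mat set"
  proof -
    have "I + (I \<inter> J) \<subseteq> I"
      using left_submodulesD(3)[OF I] by (auto simp: set_plus_mat_iff)
    then show ?thesis
      using sub[OF I int[OF I J]] sub[OF I J] by blast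
  qed
  show ?thesis
    unfolding is_lattice_def LS_def lattice_ops.simps
    by (intro conjI ballI)
      (rule left_submodules_plus int comm assoc Int_assoc Int_commute
        absorb[THEN conjunct1] absorb[THEN conjunct2]; assumption)+
qed

lemma lattice_iso_LRS:
  "lattice_iso LRS (Rlat n) (LS 1 n :: 'a :: division_ring mat set lattice_ops)"
proof -
  have "bij_betw LRS (row_echelon_matrices n) (elems (LS 1 n :: 'a mat set lattice_ops))"
    using bij_betw_LRS by (simp add: LS_def)
  from lattice_iso_THE[OF is_lattice_LS this] show ?thesis
    by (simp add: LS_def Rlat_def)
qed

section \<open>Submodules of matrices and subspaces of rows\<close>

text \<open>Rows are taken as matrices with one row, so that the subspaces \<open>V\<close> form the
  lattice \<open>LS 1 n\<close>, the case of a single row.\<close>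

definition mats_with_rows_in :: "nat \<Rightarrow> nat \<Rightarrow> 'a mat set \<Rightarrow> 'a mat set" where
  "mats_with_rows_in m n V = {X \<in> carrier_mat m n. \<forall>i<m. mat_of_row (row X i) \<in> V}"

lemma mat_of_row_add:
  assumes "A \<in> carrier_mat m n" "B \<in> carrier_mat m n" "i < m"
  shows "mat_of_row (row (A + B) i) = mat_of_row (row A i) + mat_of_row (row B i)"
  using assms by (intro eq_matI) auto

text \<open>Each row of \<open>A * X\<close> is a left combination of the rows of
  \<open>X\<close>.\<close>

lemma mats_with_rows_in_left_submodules:
  fixes V :: "'a :: division_ring mat set"
  assumes V: "V \<in> left_submodules 1 n"
  shows "mats_with_rows_in m n V \<in> left_submodules m n"
  unfolding left_submodules_def mem_Collect_eq
proof (intro conjI ballI)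
  show "mats_with_rows_in m n V \<subseteq> carrier_mat m n"
    by (auto simp: mats_with_rows_in_def)
  have "mat_of_row (row (0\<^sub>m m n) i) = 0\<^sub>m 1 n" if "i < m" for i
    using that by (intro eq_matI) auto
  then have "\<forall>i<m. mat_of_row (row (0\<^sub>m m n) i) \<in> V"
    using left_submodulesD(2)[OF V] by metis
  then show "0\<^sub>m m n \<in> mats_with_rows_in m n V"
    using zero_carrier_mat unfolding mats_with_rows_in_def by blast
next
  fix X Y assume "X \<in> mats_with_rows_in m n V" "Y \<in> mats_with_rows_in m n V"
  then show "X + Y \<in> mats_with_rows_in m n V"
    using left_submodulesD(3)[OF V] mat_of_row_add[of X m n Y] by (auto simp: mats_with_rows_in_def)
next
  fix A X :: "'a mat" assume A: "A \<in> carrier_mat m m" and "X \<in> mats_with_rows_in m n V"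
  then have X: "X \<in> carrier_mat m n" "\<And>i. i < m \<Longrightarrow> mat_of_row (row X i) \<in> V"
    by (auto simp: mats_with_rows_in_def)
  have "mat_of_row (row (A * X) i) \<in> V" if "i < m" for i
  proof -
    have "mat_of_row (row (A * X) i)
        = mat 1 n (\<lambda>(_, j). \<Sum>k\<in>{..<m}. A $$ (i, k) * mat_of_row (row X k) $$ (0, j))"
      using A X(1) that by (intro eq_matI) (auto simp: scalar_prod_def lessThan_atLeast0)
    also have "\<dots> \<in> V"
      using X(2) by (intro left_submodules_lincomb V) auto
    finally show ?thesis .
  qed
  then show "A * X \<in> mats_with_rows_in m n V"
    using A X by (simp add: mats_with_rows_in_def)
qed

text \<open>Multiplying by matrix units cuts a member of \<open>I\<close> into single rows, and a
  matrix is the sum of its rows put back in place.\<close>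

lemma mats_with_rows_in_surj:
  fixes I :: "'a :: division_ring mat set"
  assumes I: "I \<in> left_submodules m n"
  shows "\<exists>V\<in>left_submodules 1 n. mats_with_rows_in m n V = I"
proof
  \<comment> \<open>Testing \<open>v\<close> against all columns \<open>A\<close> reduces closure of
    \<open>V\<close> to closure of \<open>I\<close>: for scalars,
    \<open>A * (B * v) = (A * B) * v\<close>, where \<open>A * B\<close> is again a column.\<close>
  define V where "V = {v \<in> carrier_mat 1 n. \<forall>A\<in>carrier_mat m 1. A * v \<in> I}"
  note ID = left_submodulesD[OF I]
  show "V \<in> left_submodules 1 n"
    unfolding left_submodules_def mem_Collect_eq
  proof (intro conjI ballI)
    show "V \<subseteq> carrier_mat 1 n"
      by (auto simp: V_def)
    show "0\<^sub>m 1 n \<in> V"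
      using ID(2) by (auto simp: V_def right_mult_zero_mat)
  next
    fix u v assume "u \<in> V" "v \<in> V"
    then show "u + v \<in> V"
      using ID(3) by (auto simp: V_def mult_add_distrib_mat)
  next
    fix B v :: "'a mat" assume B: "B \<in> carrier_mat 1 1" and "v \<in> V"
    then have v: "v \<in> carrier_mat 1 n" "\<And>A. A \<in> carrier_mat m 1 \<Longrightarrow> A * v \<in> I"
      by (auto simp: V_def)
    have "A * (B * v) \<in> I" if "A \<in> carrier_mat m 1" for A
      using assoc_mult_mat[OF that B v(1)] v(2) that B by (metis mult_carrier_mat)
    then show "B * v \<in> V"
      using B v by (auto simp: V_def)
  qed
  show "mats_with_rows_in m n V = I"
  proof
    show "I \<subseteq> mats_with_rows_in m n V"
    proof
      fix X assume X: "X \<in> I"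
      have Xc: "X \<in> carrier_mat m n"
        using ID(1)[OF X] .
      have "A * mat_of_row (row X i) \<in> I" if "i < m" "A \<in> carrier_mat m 1" for A i
      proof -
        \<comment> \<open>The unit row \<open>e\<close> extracts row \<open>i\<close> of
          \<open>X\<close>, and \<open>A * e\<close> is a square matrix, which may act on
          \<open>I\<close>.\<close>
        define e :: "'a mat" where "e = mat_of_row (unit_vec m i)"
        have e: "e \<in> carrier_mat 1 m"
          by (simp add: e_def)
        have "mat_of_row (row X i) = e * X"
          using Xc that by (intro eq_matI) (auto simp: e_def)
        then have "A * mat_of_row (row X i) = (A * e) * X"
          using assoc_mult_mat[OF that(2) e Xc] by simp
        then show ?thesis
          using ID(4)[OF _ X] that(2) e by (metis mult_carrier_mat)
      qed
      then show "X \<in> mats_with_rows_in m n V"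
        using Xc by (auto simp: mats_with_rows_in_def V_def)
    qed
    show "mats_with_rows_in m n V \<subseteq> I"
    proof
      fix X assume "X \<in> mats_with_rows_in m n V"
      then have X: "X \<in> carrier_mat m n"
        "\<And>i A. i < m \<Longrightarrow> A \<in> carrier_mat m 1 \<Longrightarrow> A * mat_of_row (row X i) \<in> I"
        by (auto simp: mats_with_rows_in_def V_def)
      \<comment> \<open>\<open>X\<close> is rebuilt row by row: the first \<open>k\<close> rows are
        in place and the others are zero.\<close>
      have "mat m n (\<lambda>(i, j). if i < k then X $$ (i, j) else 0) \<in> I" if "k \<le> m" for k
        using that
      proof (induction k)
        case 0
        have "mat m n (\<lambda>(i, j). if i < 0 then X $$ (i, j) else 0) = 0\<^sub>m m n"
          by (intro eq_matI) auto
        then show ?case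
          using ID(2) by (simp only:)
      next
        case (Suc k)
        \<comment> \<open>This unit column puts row \<open>k\<close> of \<open>X\<close> back at
          height \<open>k\<close>.\<close>
        define A :: "'a mat" where "A = mat m 1 (\<lambda>(i, _). if i = k then 1 else 0)"
        have "mat m n (\<lambda>(i, j). if i < Suc k then X $$ (i, j) else 0)
            = mat m n (\<lambda>(i, j). if i < k then X $$ (i, j) else 0) + A * mat_of_row (row X k)"
        proof (rule eq_matI)
          fix i j assume "i < dim_row (mat m n (\<lambda>(i, j). if i < k then X $$ (i, j) else 0) + A * mat_of_row (row X k))"
            "j < dim_col (mat m n (\<lambda>(i, j). if i < k then X $$ (i, j) else 0) + A * mat_of_row (row X k))"
          then have "i < m" "j < n"
            using X(1) by (simp_all add: A_def)
          then show "mat m n (\<lambda>(i, j). if i < Suc k then X $$ (i, j) else 0) $$ (i, j)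
              = (mat m n (\<lambda>(i, j). if i < k then X $$ (i, j) else 0) + A * mat_of_row (row X k)) $$ (i, j)"
            using X(1) Suc.prems by (cases i k rule: linorder_cases) (simp_all add: A_def scalar_prod_def)
        qed (use X(1) in \<open>simp_all add: A_def\<close>)
        moreover have "A * mat_of_row (row X k) \<in> I"
          using Suc.prems by (intro X(2)) (auto simp: A_def)
        ultimately show ?case
          using Suc.IH Suc.prems ID(3) by (simp only: Suc_leD)
      qed
      from this[of m] have "mat m n (\<lambda>(i, j). if i < m then X $$ (i, j) else 0) \<in> I"
        by simp
      moreover have "mat m n (\<lambda>(i, j). if i < m then X $$ (i, j) else 0) = X"
        using X(1) by (intro eq_matI) auto
      ultimately show "X \<in> I"
        by simp
    qed
  qed
qed

text \<open>A vector of \<open>V\<close> is detected by the matrix all of whose rows equal it;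
  \<open>m \<ge> 1\<close> guarantees a row to read it off. Injectivity of
  \<open>mats_with_rows_in\<close> follows.\<close>

lemma mats_with_rows_in_subset_iff:
  assumes "m \<ge> 1" and V: "V \<in> left_submodules 1 n"
  shows "mats_with_rows_in m n V \<subseteq> mats_with_rows_in m n W \<longleftrightarrow> V \<subseteq> W"
proof
  assume sub: "mats_with_rows_in m n V \<subseteq> mats_with_rows_in m n W"
  show "V \<subseteq> W"
  proof
    fix v assume v: "v \<in> V"
    define X where "X = mat m n (\<lambda>(_, j). v $$ (0, j))"
    have row: "mat_of_row (row X i) = v" if "i < m" for i
      using that left_submodulesD(1)[OF V v] by (intro eq_matI) (auto simp: X_def)
    then have "X \<in> mats_with_rows_in m n V"
      using v by (auto simp: mats_with_rows_in_def X_def)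
    then have "mat_of_row (row X 0) \<in> W"
      using sub assms(1) by (auto simp: mats_with_rows_in_def)
    then show "v \<in> W"
      using row assms(1) by simp
  qed
qed (auto simp: mats_with_rows_in_def)

text \<open>For the harder inclusion each row is split separately into a part in \<open>V\<close>
  and a part in \<open>W\<close>; the chosen parts are stacked into two matrices.\<close>

lemma mats_with_rows_in_plus:
  assumes V: "V \<in> left_submodules 1 n" and W: "W \<in> left_submodules 1 n"
  shows "mats_with_rows_in m n (V + W) = mats_with_rows_in m n V + mats_with_rows_in m n W"
proof
  show "mats_with_rows_in m n V + mats_with_rows_in m n W \<subseteq> mats_with_rows_in m n (V + W)"
  proof
    fix X assume "X \<in> mats_with_rows_in m n V + mats_with_rows_in m n W"
    then obtain A B where "X = A + B" "A \<in> mats_with_rows_in m n V" "B \<in> mats_with_rows_in m n W"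
      by (auto simp: set_plus_mat_iff)
    then show "X \<in> mats_with_rows_in m n (V + W)"
      using mat_of_row_add[of A m n B] by (auto simp: mats_with_rows_in_def)
  qed
  show "mats_with_rows_in m n (V + W) \<subseteq> mats_with_rows_in m n V + mats_with_rows_in m n W"
  proof
    fix X assume "X \<in> mats_with_rows_in m n (V + W)"
    then have X: "X \<in> carrier_mat m n" "\<And>i. i < m \<Longrightarrow> mat_of_row (row X i) \<in> V + W"
      by (auto simp: mats_with_rows_in_def)
    then have "\<forall>i. \<exists>v w. i < m \<longrightarrow> v \<in> V \<and> w \<in> W \<and> mat_of_row (row X i) = v + w"
      unfolding set_plus_mat_iff by blast
    then obtain v w where vw: "\<And>i. i < m \<Longrightarrow> v i \<in> V" "\<And>i. i < m \<Longrightarrow> w i \<in> W"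
      "\<And>i. i < m \<Longrightarrow> mat_of_row (row X i) = v i + w i"
      by metis
    define A where "A = mat m n (\<lambda>(i, j). v i $$ (0, j))"
    define B where "B = mat m n (\<lambda>(i, j). w i $$ (0, j))"
    have c: "v i \<in> carrier_mat 1 n" "w i \<in> carrier_mat 1 n" if "i < m" for i
      using vw that left_submodulesD(1)[OF V] left_submodulesD(1)[OF W] by auto
    have "mat_of_row (row A i) = v i" "mat_of_row (row B i) = w i" if "i < m" for i
      using that c[OF that] by (auto intro!: eq_matI simp: A_def B_def)
    then have "A \<in> mats_with_rows_in m n V" "B \<in> mats_with_rows_in m n W"
      using vw by (auto simp: mats_with_rows_in_def A_def B_def)
    moreover have "X = A + B"
    proof (rule eq_matI)
      fix i j assume "i < dim_row (A + B)" "j < dim_col (A + B)"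
      then have ij: "i < m" "j < n"
        by (auto simp: A_def B_def)
      have "X $$ (i, j) = mat_of_row (row X i) $$ (0, j)"
        using X(1) ij by simp
      also have "\<dots> = (A + B) $$ (i, j)"
        unfolding vw(3)[OF ij(1)] using ij c[OF ij(1)] by (simp add: A_def B_def)
      finally show "X $$ (i, j) = (A + B) $$ (i, j)" .
    qed (use X(1) in \<open>auto simp: A_def B_def\<close>)
    ultimately show "X \<in> mats_with_rows_in m n V + mats_with_rows_in m n W"
      by (auto simp: set_plus_mat_iff)
  qed
qed

lemma lattice_iso_mats_with_rows_in:
  assumes "m \<ge> 1"
  shows "lattice_iso (mats_with_rows_in m n) (LS 1 n) (LS m n :: 'a :: division_ring mat set lattice_ops)"
proof (rule lattice_isoI)
  have "inj_on (mats_with_rows_in m n) (left_submodules 1 n :: 'a mat set set)"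
    using mats_with_rows_in_subset_iff[OF assms] by (intro inj_onI equalityI) blast+
  moreover have "mats_with_rows_in m n ` left_submodules 1 n = (left_submodules m n :: 'a mat set set)"
    using mats_with_rows_in_surj mats_with_rows_in_left_submodules by blast
  ultimately show "bij_betw (mats_with_rows_in m n) (elems (LS 1 n)) (elems (LS m n :: 'a mat set lattice_ops))"
    by (simp add: bij_betw_def LS_def)
  show "is_lattice (LS 1 n :: 'a mat set lattice_ops)"
    by (rule is_lattice_LS)
  fix V W :: "'a mat set" assume "V \<in> elems (LS 1 n)" "W \<in> elems (LS 1 n)"
  then show "mats_with_rows_in m n (lub (LS 1 n) V W)
      = lub (LS m n) (mats_with_rows_in m n V) (mats_with_rows_in m n W)"
    by (simp add: LS_def mats_with_rows_in_plus)
  show "mats_with_rows_in m n (glb (LS 1 n) V W)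
      = glb (LS m n) (mats_with_rows_in m n V) (mats_with_rows_in m n W)"
    by (auto simp: LS_def mats_with_rows_in_def)
qed

text \<open>The coefficients that express row \<open>i\<close> of a matrix through the rows of
  \<open>R\<close> form row \<open>i\<close> of the left factor \<open>X\<close>.\<close>

lemma mats_with_rows_in_LRS:
  assumes R: "R \<in> carrier_mat k n"
  shows "mats_with_rows_in m n (LRS R) = set_times_mat (carrier_mat m k) R"
proof
  show "set_times_mat (carrier_mat m k) R \<subseteq> mats_with_rows_in m n (LRS R)"
  proof
    fix Y assume "Y \<in> set_times_mat (carrier_mat m k) R"
    then obtain X where X: "X \<in> carrier_mat m k" "Y = X * R"
      by (auto simp: set_times_mat_def)
    have "mat_of_row (row Y i) = mat 1 (dim_col R) (\<lambda>(_, j). \<Sum>l<dim_row R. X $$ (i, l) * R $$ (l, j))"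
      if "i < m" for i
      using X R that by (intro eq_matI) (auto simp: scalar_prod_def lessThan_atLeast0)
    then show "Y \<in> mats_with_rows_in m n (LRS R)"
      using X R unfolding mats_with_rows_in_def LRS_def by auto
  qed
  show "mats_with_rows_in m n (LRS R) \<subseteq> set_times_mat (carrier_mat m k) R"
  proof
    fix Y assume "Y \<in> mats_with_rows_in m n (LRS R)"
    then have Y: "Y \<in> carrier_mat m n"
      "\<forall>i<m. \<exists>c. mat_of_row (row Y i) = mat 1 n (\<lambda>(_, j). \<Sum>l<k. c l * R $$ (l, j))"
      using R by (auto simp: mats_with_rows_in_def LRS_def)
    then have "\<forall>i\<in>{..<m}. \<exists>c. mat_of_row (row Y i) = mat 1 n (\<lambda>(_, j). \<Sum>l<k. c l * R $$ (l, j))"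
      by blast
    from bchoice[OF this] obtain c where
      c: "\<And>i. i < m \<Longrightarrow> mat_of_row (row Y i) = mat 1 n (\<lambda>(_, j). \<Sum>l<k. c i l * R $$ (l, j))"
      by blast
    have "Y = mat m k (\<lambda>(i, l). c i l) * R"
    proof (rule eq_matI)
      fix i j assume "i < dim_row (mat m k (\<lambda>(i, l). c i l) * R)" "j < dim_col (mat m k (\<lambda>(i, l). c i l) * R)"
      then have ij: "i < m" "j < n"
        using R by auto
      have "Y $$ (i, j) = mat_of_row (row Y i) $$ (0, j)"
        using Y(1) ij by simp
      also have "\<dots> = (mat m k (\<lambda>(i, l). c i l) * R) $$ (i, j)"
        using c ij R by (simp add: scalar_prod_def lessThan_atLeast0)
      finally show "Y $$ (i, j) = (mat m k (\<lambda>(i, l). c i l) * R) $$ (i, j)" .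
    qed (use Y(1) R in auto)
    then show "Y \<in> set_times_mat (carrier_mat m k) R"
      by (auto simp: set_times_mat_def)
  qed
qed

lemma left_submodules_iso_row_echelon:
  assumes "m \<ge> 1"
  shows "\<exists>\<phi>. lattice_iso \<phi> (LS m n :: 'a :: division_ring mat set lattice_ops) (Rlat n)
    \<and> (\<forall>I\<in>elems (LS m n). I = set_times_mat (carrier_mat m n) (\<phi> I))"
proof -
  have iso: "lattice_iso (mats_with_rows_in m n \<circ> LRS) (Rlat n) (LS m n :: 'a mat set lattice_ops)"
    by (rule lattice_iso_comp[OF lattice_iso_LRS lattice_iso_mats_with_rows_in[OF assms]])
  \<comment> \<open>The map sends \<open>I\<close> to the echelon matrix whose row space contains
    exactly the rows allowed in \<open>I\<close>; the product formula is then
    \<open>mats_with_rows_in_LRS\<close> with \<open>k = n\<close>.\<close>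
  define \<phi> :: "'a mat set \<Rightarrow> 'a mat" where
    "\<phi> = inv_into (elems (Rlat n)) (mats_with_rows_in m n \<circ> LRS)"
  have "I = set_times_mat (carrier_mat m n) (\<phi> I)" if "I \<in> elems (LS m n)" for I
  proof -
    have img: "I \<in> (mats_with_rows_in m n \<circ> LRS) ` elems (Rlat n)"
      using iso that by (auto simp: lattice_iso_def bij_betw_def)
    have "\<phi> I \<in> carrier_mat n n"
      using inv_into_into[OF img] by (simp add: \<phi>_def Rlat_def row_echelon_matrices_def)
    moreover have "mats_with_rows_in m n (LRS (\<phi> I)) = I"
      using f_inv_into_f[OF img] by (simp add: \<phi>_def)
    ultimately show ?thesis
      using mats_with_rows_in_LRS by blast
  qed
  then show ?thesis
    using lattice_iso_inv[OF iso] unfolding \<phi>_def by blast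
qed


section \<open>The opposite division ring\<close>

text \<open>A type of its own, so that the reversed multiplication can be a second
  \<open>division_ring\<close> structure and the results on left submodules apply to it.\<close>

datatype 'a opp = Opp (unopp: 'a)

instantiation opp :: (division_ring) division_ring
begin

definition "0 = Opp 0"
definition "1 = Opp 1"
definition "a + b = Opp (unopp a + unopp b)"
definition "a - b = Opp (unopp a - unopp b)"
definition "- a = Opp (- unopp a)"
definition "a * b = Opp (unopp b * unopp a)"
definition inverse_opp :: "'a opp \<Rightarrow> 'a opp" where
  "inverse_opp a = Opp (inverse (unopp a))"
text \<open>Division is multiplication by the inverse on the right, which the reversal moves to the
  left.\<close>

definition divide_opp :: "'a opp \<Rightarrow> 'a opp \<Rightarrow> 'a opp" where
  "divide_opp a b = Opp (inverse (unopp b) * unopp a)"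

instance
  by (standard;
     auto simp: zero_opp_def one_opp_def plus_opp_def minus_opp_def uminus_opp_def times_opp_def
      inverse_opp_def divide_opp_def opp.expand algebra_simps;
     metis left_inverse right_inverse opp.collapse)

end

lemma unopp_simps [simp]:
  "unopp 0 = 0" "unopp 1 = 1" "unopp (a + b) = unopp a + unopp b" "unopp (a * b) = unopp b * unopp a"
  by (simp_all add: zero_opp_def one_opp_def plus_opp_def times_opp_def)

lemma unopp_eq_iff [simp]: "unopp a = 0 \<longleftrightarrow> a = 0" "unopp a = 1 \<longleftrightarrow> a = 1"
  by (cases a; simp add: zero_opp_def one_opp_def)+

lemma unopp_sum: "unopp (sum f S) = (\<Sum>i\<in>S. unopp (f i))"
  by (induction S rule: infinite_finite_induct) auto

section \<open>Transposition between a division ring and its opposite\<close>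

definition opp_transpose :: "'a mat \<Rightarrow> 'a opp mat" where
  "opp_transpose A = mat (dim_col A) (dim_row A) (\<lambda>(i, j). Opp (A $$ (j, i)))"

definition unopp_transpose :: "'a opp mat \<Rightarrow> 'a mat" where
  "unopp_transpose A = mat (dim_col A) (dim_row A) (\<lambda>(i, j). unopp (A $$ (j, i)))"

lemma unopp_transpose_opp_transpose [simp]: "unopp_transpose (opp_transpose A) = A"
  by (rule eq_matI) (auto simp: opp_transpose_def unopp_transpose_def)

lemma opp_transpose_unopp_transpose [simp]: "opp_transpose (unopp_transpose A) = A"
  by (rule eq_matI) (auto simp: opp_transpose_def unopp_transpose_def)

lemma inj_unopp_transpose: "inj unopp_transpose"
  by (metis injI opp_transpose_unopp_transpose)

lemma unopp_transpose_carrier [simp]: "unopp_transpose A \<in> carrier_mat m n \<longleftrightarrow> A \<in> carrier_mat n m"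
  unfolding unopp_transpose_def carrier_mat_def by auto

lemma opp_transpose_carrier [simp]: "opp_transpose A \<in> carrier_mat m n \<longleftrightarrow> A \<in> carrier_mat n m"
  unfolding opp_transpose_def carrier_mat_def by auto

lemma image_unopp_transpose_carrier: "unopp_transpose ` carrier_mat n m = carrier_mat m n"
proof
  show "carrier_mat m n \<subseteq> unopp_transpose ` carrier_mat n m"
    by (metis image_eqI opp_transpose_carrier subsetI unopp_transpose_opp_transpose)
qed auto

lemma unopp_transpose_add:
  assumes "A \<in> carrier_mat m n" "B \<in> carrier_mat m n"
  shows "unopp_transpose (A + B) = unopp_transpose A + unopp_transpose B"
  using assms by (intro eq_matI) (auto simp: unopp_transpose_def)

text \<open>Transposition swaps the factors of the matrix product and the opposite multiplication
  swaps the factors in every summand. Without commutativity both swaps are required.\<close>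

lemma unopp_transpose_mult:
  assumes "A \<in> carrier_mat m k" "B \<in> carrier_mat k n"
  shows "unopp_transpose (A * B) = unopp_transpose B * unopp_transpose A"
  using assms by (intro eq_matI) (auto simp: unopp_transpose_def scalar_prod_def unopp_sum)

lemma unopp_transpose_zero: "unopp_transpose (0\<^sub>m m n) = 0\<^sub>m n m"
  by (rule eq_matI) (auto simp: unopp_transpose_def)

text \<open>As the transposition is injective, additive and reverses products, each closure
  condition on the image is equivalent to the one on \<open>J\<close>. The equivalence yields both
  inclusions for the bijection of submodules.\<close>

lemma right_submodules_image_unopp_transpose:
  fixes J :: "'a :: division_ring opp mat set"
  shows "unopp_transpose ` J \<in> right_submodules m n \<longleftrightarrow> J \<in> left_submodules n m"
proof -
  have sub: "unopp_transpose ` J \<subseteq> carrier_mat m n \<longleftrightarrow> J \<subseteq> carrier_mat n m"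
    by auto
  have zero: "0\<^sub>m m n \<in> unopp_transpose ` J \<longleftrightarrow> 0\<^sub>m n m \<in> J"
    using inj_image_mem_iff[OF inj_unopp_transpose] unopp_transpose_zero by metis
  have add: "(\<forall>X\<in>unopp_transpose ` J. \<forall>Y\<in>unopp_transpose ` J. X + Y \<in> unopp_transpose ` J)
      \<longleftrightarrow> (\<forall>X\<in>J. \<forall>Y\<in>J. X + Y \<in> J)" if "J \<subseteq> carrier_mat n m"
  proof -
    have "unopp_transpose X + unopp_transpose Y \<in> unopp_transpose ` J \<longleftrightarrow> X + Y \<in> J"
      if "X \<in> J" "Y \<in> J" for X Y
    proof -
      have eq: "unopp_transpose (X + Y) = unopp_transpose X + unopp_transpose Y"
        using that \<open>J \<subseteq> _\<close> by (intro unopp_transpose_add[of _ n m]) auto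
      show ?thesis
        unfolding eq[symmetric] by (rule inj_image_mem_iff[OF inj_unopp_transpose])
    qed
    then show ?thesis
      by simp
  qed
  have mult: "(\<forall>A\<in>carrier_mat n n. \<forall>X\<in>unopp_transpose ` J. X * A \<in> unopp_transpose ` J)
      \<longleftrightarrow> (\<forall>A\<in>carrier_mat n n. \<forall>X\<in>J. A * X \<in> J)" if "J \<subseteq> carrier_mat n m"
  proof -
    have "unopp_transpose X * unopp_transpose A \<in> unopp_transpose ` J \<longleftrightarrow> A * X \<in> J"
      if "X \<in> J" "A \<in> carrier_mat n n" for X A
    proof -
      have eq: "unopp_transpose (A * X) = unopp_transpose X * unopp_transpose A"
        using that \<open>J \<subseteq> _\<close> by (intro unopp_transpose_mult[of _ n n _ m]) auto
      show ?thesis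
        unfolding eq[symmetric] by (rule inj_image_mem_iff[OF inj_unopp_transpose])
    qed
    \<comment> \<open>All square matrices are transposes, so the acting matrices may be quantified
      over the image.\<close>
    then have "(\<forall>A\<in>unopp_transpose ` carrier_mat n n. \<forall>X\<in>unopp_transpose ` J. X * A \<in> unopp_transpose ` J)
        \<longleftrightarrow> (\<forall>A\<in>carrier_mat n n. \<forall>X\<in>J. A * X \<in> J)"
      by simp
    then show ?thesis
      unfolding image_unopp_transpose_carrier .
  qed
  show ?thesis
    unfolding right_submodules_def left_submodules_def mem_Collect_eq sub zero
    by (intro conj_cong refl add mult)
qed

lemma lattice_iso_image_unopp_transpose:
  "lattice_iso (image unopp_transpose) (LS n m) (RS m n :: 'a :: division_ring mat set lattice_ops)"
proof (rule lattice_isoI)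
  have "I \<in> image unopp_transpose ` left_submodules n m" if "I \<in> right_submodules m n" for I :: "'a mat set"
  proof
    show eq: "I = unopp_transpose ` opp_transpose ` I"
      by (simp add: image_image)
    show "opp_transpose ` I \<in> left_submodules n m"
      using that eq right_submodules_image_unopp_transpose by metis
  qed
  moreover have "inj_on (image unopp_transpose) (left_submodules n m)"
    by (intro inj_onI) (simp add: inj_image_eq_iff[OF inj_unopp_transpose])
  ultimately show "bij_betw (image unopp_transpose) (elems (LS n m)) (elems (RS m n :: 'a mat set lattice_ops))"
    using right_submodules_image_unopp_transpose unfolding bij_betw_def LS_def RS_def lattice_ops.simps
    by blast
  fix I J :: "'a opp mat set" assume "I \<in> elems (LS n m)" "J \<in> elems (LS n m)"
  then have IJ: "I \<in> left_submodules n m" "J \<in> left_submodules n m"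
    by (simp_all add: LS_def)
  have add: "unopp_transpose (A + B) = unopp_transpose A + unopp_transpose B" if "A \<in> I" "B \<in> J" for A B
    using left_submodulesD(1)[OF IJ(1) that(1)] left_submodulesD(1)[OF IJ(2) that(2)]
    by (rule unopp_transpose_add)
  have "unopp_transpose ` (I + J) = unopp_transpose ` I + unopp_transpose ` J"
  proof (intro equalityI subsetI)
    fix X assume "X \<in> unopp_transpose ` (I + J)"
    then show "X \<in> unopp_transpose ` I + unopp_transpose ` J"
      by (auto elim!: set_plus_elim simp: add intro!: set_plus_intro)
  next
    fix X assume "X \<in> unopp_transpose ` I + unopp_transpose ` J"
    then show "X \<in> unopp_transpose ` (I + J)"
      by (auto elim!: set_plus_elim simp: add[symmetric] intro!: imageI set_plus_intro)
  qed
  then show "unopp_transpose ` lub (LS n m) I J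
      = lub (RS m n) (unopp_transpose ` I) (unopp_transpose ` J)"
    by (simp add: LS_def RS_def)
  show "unopp_transpose ` glb (LS n m) I J
      = glb (RS m n) (unopp_transpose ` I) (unopp_transpose ` J)"
    by (simp add: LS_def RS_def image_Int[OF inj_unopp_transpose])
qed (rule is_lattice_LS)

text \<open>Scalars to the left of rows over the opposite ring become scalars to the right of
  columns.\<close>

lemma RCS_unopp_transpose: "RCS (unopp_transpose R) = unopp_transpose ` LRS R"
proof -
  have "unopp_transpose (mat 1 (dim_col R) (\<lambda>(_, j). \<Sum>i<dim_row R. c i * R $$ (i, j)))
      = mat (dim_col R) 1 (\<lambda>(i, _). \<Sum>j<dim_row R. unopp_transpose R $$ (i, j) * unopp (c j))" for c
    by (rule eq_matI) (auto simp: unopp_transpose_def unopp_sum)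
  then have "unopp_transpose ` LRS R
      = {mat (dim_col R) 1 (\<lambda>(i, _). \<Sum>j<dim_row R. unopp_transpose R $$ (i, j) * unopp (c j)) | c. True}"
    unfolding LRS_def by (auto simp: image_iff) metis
  \<comment> \<open>Every family of scalars is the \<open>unopp\<close> of a family, namely of its
    \<open>Opp\<close>.\<close>
  also have "\<dots> = {mat (dim_col R) 1 (\<lambda>(i, _). \<Sum>j<dim_row R. unopp_transpose R $$ (i, j) * c j) | c. True}"
    (is "{?F (\<lambda>j. unopp (c j)) | c. True} = {?F c | c. True}")
  proof (intro equalityI subsetI)
    fix X assume "X \<in> {?F c | c. True}"
    then obtain c where "X = ?F c"
      by blast
    then have "X = ?F (\<lambda>j. unopp (Opp (c j)))"
      by simp
    then show "X \<in> {?F (\<lambda>j. unopp (c j)) | c. True}"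
      by (intro CollectI exI[of _ "\<lambda>j. Opp (c j)"]) simp
  next
    fix X assume "X \<in> {?F (\<lambda>j. unopp (c j)) | c. True}"
    then obtain c where "X = ?F (\<lambda>j. unopp (c j))"
      by blast
    then show "X \<in> {?F c | c. True}"
      by (intro CollectI exI[of _ "\<lambda>j. unopp (c j)"]) simp
  qed
  finally show ?thesis
    by (simp add: RCS_def unopp_transpose_def)
qed

text \<open>The echelon conditions only ask whether entries are 0 or 1, which \<open>unopp\<close>
  preserves and reflects.\<close>

lemma col_echelon_unopp_transpose:
  "unopp_transpose R \<in> col_echelon_matrices m \<longleftrightarrow> R \<in> row_echelon_matrices m"
proof -
  \<comment> \<open>The two transpositions cancel: \<open>A\<close> is \<open>R\<close> with
    \<open>unopp\<close> applied to each entry.\<close>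
  define A where "A = transpose_mat (unopp_transpose R)"
  have dim: "dim_row A = dim_row R" "dim_col A = dim_col R"
    by (simp_all add: A_def unopp_transpose_def)
  have entry: "A $$ (i, j) = unopp (R $$ (i, j))" if "i < dim_row R" "j < dim_col R" for i j
    using that by (simp add: A_def unopp_transpose_def)
  have zero: "zero_row A i \<longleftrightarrow> zero_row R i" if "i < dim_row R" for i
    using that by (simp add: zero_row_def dim entry)
  have lead: "lead_pos A i = lead_pos R i" if "i < dim_row R" for i
    unfolding lead_pos_def dim using that entry by (metis unopp_eq_iff(1))
  \<comment> \<open>Restricted to nonzero rows, where the leading position is known to be a column
    index.\<close>
  have lead_entry: "A $$ (k, lead_pos R i) = unopp (R $$ (k, lead_pos R i))"
    if "i < dim_row R" "k < dim_row R" "\<not> zero_row R i" for i k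
    using that entry lead_pos_props(1) by blast
  have "row_reduced_echelon A \<longleftrightarrow> row_reduced_echelon R"
    unfolding row_reduced_echelon_def dim
    using zero lead lead_entry by (intro conj_cong all_cong1 imp_cong) auto
  then show ?thesis
    by (simp add: col_echelon_matrices_def row_echelon_matrices_def A_def)
qed

lemma bij_betw_unopp_transpose:
  "bij_betw unopp_transpose (row_echelon_matrices m) (col_echelon_matrices m)"
  unfolding bij_betw_def
proof
  show "inj_on unopp_transpose (row_echelon_matrices m)"
    using inj_unopp_transpose by (rule inj_on_subset) simp
  have "C \<in> unopp_transpose ` row_echelon_matrices m" if "C \<in> col_echelon_matrices m" for C :: "'a mat"
    using that col_echelon_unopp_transpose[of "opp_transpose C" m]
    by (metis image_eqI unopp_transpose_opp_transpose)
  then show "unopp_transpose ` row_echelon_matrices m = (col_echelon_matrices m :: 'a mat set)"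
    using col_echelon_unopp_transpose by blast
qed

text \<open>Taking row spaces and then transposing agrees with transposing and then taking column
  spaces. Thus \<open>RCS\<close> inherits bijectivity from \<open>LRS\<close>,
  \<open>lattice_iso_THE\<close> applies to \<open>Clat m\<close>, and the composite with the
  inverse of \<open>RCS\<close> is the transposition itself.\<close>

lemma lattice_iso_unopp_transpose:
  "lattice_iso unopp_transpose (Rlat m) (Clat m :: 'a :: division_ring mat lattice_ops)"
proof -
  have iso: "lattice_iso (image unopp_transpose \<circ> LRS) (Rlat m) (RS m 1 :: 'a mat set lattice_ops)"
    using lattice_iso_comp[OF lattice_iso_LRS lattice_iso_image_unopp_transpose] .
  have RCS: "RCS (unopp_transpose R) = (image unopp_transpose \<circ> LRS) R" for R :: "'a opp mat"
    by (simp add: RCS_unopp_transpose)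
  have "bij_betw (RCS \<circ> unopp_transpose) (row_echelon_matrices m) (elems (RS m 1 :: 'a mat set lattice_ops))"
    using iso by (simp add: comp_def RCS lattice_iso_def Rlat_def)
  then have bij: "bij_betw RCS (col_echelon_matrices m) (elems (RS m 1 :: 'a mat set lattice_ops))"
    using bij_betw_comp_iff[OF bij_betw_unopp_transpose] by blast
  have "is_lattice (RS m 1 :: 'a mat set lattice_ops)"
    using iso by (simp add: lattice_iso_def)
  from lattice_iso_THE[OF this bij]
  have "lattice_iso RCS (Clat m) (RS m 1 :: 'a mat set lattice_ops)"
    by (simp add: RS_def Clat_def)
  from lattice_iso_comp[OF iso lattice_iso_inv[OF this]]
  show ?thesis
  proof (rule lattice_iso_cong)
    fix R :: "'a opp mat" assume "R \<in> elems (Rlat m)"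
    then have "unopp_transpose R \<in> elems (Clat m)"
      by (simp add: Rlat_def Clat_def col_echelon_unopp_transpose)
    moreover have "inj_on RCS (elems (Clat m :: 'a mat lattice_ops))"
      using bij by (simp add: bij_betw_def Clat_def)
    ultimately show "(inv_into (elems (Clat m)) RCS \<circ> (image unopp_transpose \<circ> LRS)) R = unopp_transpose R"
      by (simp add: RCS_unopp_transpose[symmetric] inv_into_f_f)
  qed
qed

text \<open>The result for left submodules is used over the opposite ring with the dimensions
  exchanged, so the number of rows that must be positive there is \<open>n\<close>.\<close>

lemma right_submodules_iso_col_echelon:
  assumes "n \<ge> 1"
  shows "\<exists>\<phi>. lattice_iso \<phi> (RS m n :: 'a :: division_ring mat set lattice_ops) (Clat m)
    \<and> (\<forall>I\<in>elems (RS m n). I = mat_times_set (\<phi> I) (carrier_mat m n))"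
proof -
  from left_submodules_iso_row_echelon[OF assms]
  obtain \<psi> where *: "lattice_iso \<psi> (LS n m :: 'a opp mat set lattice_ops) (Rlat m) \<and>
      (\<forall>J\<in>elems (LS n m). J = set_times_mat (carrier_mat n m) (\<psi> J))" ..
  note \<psi> = conjunct1[OF *] bspec[OF conjunct2[OF *]]
  define T where "T = (inv_into (elems (LS n m)) (image unopp_transpose) :: 'a mat set \<Rightarrow> 'a opp mat set)"
  have T: "lattice_iso T (RS m n) (LS n m)"
    unfolding T_def by (rule lattice_iso_inv[OF lattice_iso_image_unopp_transpose])
  have "lattice_iso (unopp_transpose \<circ> (\<psi> \<circ> T)) (RS m n) (Clat m)"
    by (rule lattice_iso_comp[OF lattice_iso_comp[OF T \<psi>(1)] lattice_iso_unopp_transpose])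
  moreover have "I = mat_times_set ((unopp_transpose \<circ> (\<psi> \<circ> T)) I) (carrier_mat m n)"
    if I: "I \<in> elems (RS m n)" for I
  proof -
    define R where "R = \<psi> (T I)"
    have TI: "T I \<in> elems (LS n m)"
      using T I by (auto simp: lattice_iso_def bij_betw_def)
    then have R: "R \<in> carrier_mat m m"
      using \<psi>(1) by (auto simp: R_def lattice_iso_def bij_betw_def Rlat_def row_echelon_matrices_def)
    have "image unopp_transpose ` elems (LS n m) = elems (RS m n :: 'a mat set lattice_ops)"
      using lattice_iso_image_unopp_transpose by (auto simp: lattice_iso_def bij_betw_def)
    then have "I = unopp_transpose ` T I"
      unfolding T_def using I by (simp add: f_inv_into_f)
    also have "\<dots> = unopp_transpose ` set_times_mat (carrier_mat n m) R"
      unfolding R_def using \<psi>(2)[OF TI] by (rule arg_cong)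
    also have "\<dots> = (\<lambda>X. unopp_transpose (X * R)) ` carrier_mat n m"
      by (auto simp: set_times_mat_def)
    \<comment> \<open>Product reversal turns right multiplication by \<open>R\<close> into left
      multiplication by its transpose.\<close>
    also have "\<dots> = (\<lambda>X. unopp_transpose R * X) ` unopp_transpose ` carrier_mat n m"
      unfolding image_image using R by (intro image_cong refl unopp_transpose_mult)
    also have "\<dots> = mat_times_set (unopp_transpose R) (carrier_mat m n)"
      by (auto simp: image_unopp_transpose_carrier mat_times_set_def)
    finally show ?thesis
      by (simp add: R_def)
  qed
  ultimately show ?thesis
    by (intro exI conjI ballI)
qed

theorem theorem1p2:
  fixes m n :: nat
  assumes "m \<ge> 1" and "n \<ge> 1"
  shows
    "((\<exists>\<phi> :: 'a :: division_ring mat set \<Rightarrow> 'a mat.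
         lattice_iso \<phi> (LS m n) (Rlat n) \<and>
         (\<forall>I\<in>elems (LS m n). I = set_times_mat (carrier_mat m n) (\<phi> I))) \<and>
      (\<forall>k\<ge>1. lattice_isomorphic (LS k n :: 'a mat set lattice_ops) (Rlat n :: 'a mat lattice_ops))) \<and>
     ((\<exists>\<phi> :: 'a mat set \<Rightarrow> 'a mat.
         lattice_iso \<phi> (RS m n) (Clat m) \<and>
         (\<forall>I\<in>elems (RS m n). I = mat_times_set (\<phi> I) (carrier_mat m n))) \<and>
      (\<forall>k\<ge>1. lattice_isomorphic (RS m k :: 'a mat set lattice_ops) (Clat m :: 'a mat lattice_ops)))"
proof (intro conjI allI impI)
  show "lattice_isomorphic (LS k n :: 'a mat set lattice_ops) (Rlat n :: 'a mat lattice_ops)" if "k \<ge> 1" for k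
    using left_submodules_iso_row_echelon[OF that] unfolding lattice_isomorphic_def by blast
  show "lattice_isomorphic (RS m k :: 'a mat set lattice_ops) (Clat m :: 'a mat lattice_ops)" if "k \<ge> 1" for k
    using right_submodules_iso_col_echelon[OF that] unfolding lattice_isomorphic_def by blast
qed (rule left_submodules_iso_row_echelon[OF assms(1)] right_submodules_iso_col_echelon[OF assms(2)])+

end
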